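(* Let $\mathcal{F}\subseteq\omega^\omega$ be a nonempty closed mass problem (closed in the Baire topology) whose Medvedev degree is not $\mathbf{0}$. Then ${\rm Th}(\mathfrak{M}/\mathcal{F})\subsetneq {\sf Jan}$.
   Context: A mass problem is a subset of Baire space $\omega^\omega$. For mass problems $\mathcal{A},\mathcal{B}$, $\mathcal{A}\le_M\mathcal{B}$ (Medvedev reducibility) iff there is a partial Turing functional $\Psi$ such that for every $f\in\mathcal{B}$, $\Psi(f)$ is defined and $\Psi(f)\in\mathcal{A}$; $\equiv_M$ is the induced equivalence and its classes are the Medvedev degrees (M-degrees), forming the poset $\mathfrak{M}$ with least element $\mathbf{0}$ (degree of any mass problem containing a computable function) and greatest element $\mathbf{1}$ (degree of $\emptyset$). With join $\mathcal{A}+\mathcal{B}=\{f\oplus g: f\in\mathcal{A}, g\in\mathcal{B}\}$ (where $(f\oplus g)(2x)=f(x)$, $(f\oplus g)(2x+1)=g(x)$), meet $\mathcal{A}\times\mathcal{B}=\{\langle 0\rangle^\frown f: f\in\mathcal{A}\}\cup\{\langle1\rangle^\frown g:g\in\mathcal{B}\}$, and implication $\mathcal{A}\rightarrow\mathcal{B}=\{\langle z\rangle^\frown f: \forall g\in\mathcal{B}\ (\Phi_z(g\oplus f)\in\mathcal{A})\}$ ($\Phi_z$ the $z$-th partial Turing functional), $\mathfrak{M}$ is a Brouwer algebra, i.e. a bounded distributive lattice with $a\rightarrow b=\min\{c: a+c\ge b\}$. For a Brouwer algebra $\mathfrak{L}$ and $a\in\mathfrak{L}$, $\mathfrak{L}/a$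 denotes the Brouwer algebra given by the initial segment $[0,a]$ with the same join, meet and $\rightarrow$, top element $a$, and negation $\neg b=b\rightarrow a$ (equivalently, the quotient of $\mathfrak{L}$ by the principal filter generated by $a$); $\mathfrak{M}/\mathcal{A}$ means $\mathfrak{M}/\deg_M(\mathcal{A})$. For a Brouwer algebra $\mathfrak{L}$, ${\rm Th}(\mathfrak{L})$ is the set of propositional formulas that evaluate to the top element under every valuation of the variables in $\mathfrak{L}$, where $\wedge$ is interpreted as join $+$, $\vee$ as meet $\times$, $\rightarrow$ as $\rightarrow$, and $\neg p$ as $p\rightarrow 1$ (with $1$ the top). ${\sf Jan}$ is the intermediate logic ${\sf IPC}+(\neg p\vee\neg\neg p)$, where ${\sf IPC}$ is intuitionistic propositional logic.
   Formalization: Th is taken as the formulas always evaluating to the least element 0 (with the top element, p∧¬p would always be valid and the claim false), and 𝒜→ℬ is taken with 𝒜 and ℬ exchanged in the displayed formula, so that a→b = min{c : a+c ≥ b} holds. *)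

theory Defs
  imports "HOL-Library.Nat_Bijection" "HOL-Analysis.Function_Topology"
begin

section \<open>Turing functionals\<close>

text \<open>
  Programs for partial recursive functions relative to an oracle \<open>f :: nat \<Rightarrow> nat\<close>. All functions are
  unary; several arguments are packed with the pairing function \<^const>\<open>prod_encode\<close>.
\<close>

datatype prog =
    Zero | Succ | Fst | Snd | Oracle
  | Pairing prog prog | Comp prog prog | PrimRec prog prog | Mu prog

inductive run :: "(nat \<Rightarrow> nat) \<Rightarrow> prog \<Rightarrow> nat \<Rightarrow> nat \<Rightarrow> bool" for f where
  run_Zero: "run f Zero x 0"
| run_Succ: "run f Succ x (Suc x)"
| run_Fst: "run f Fst x (fst (prod_decode x))"
| run_Snd: "run f Snd x (snd (prod_decode x))"
| run_Oracle: "run f Oracle x (f x)"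
| run_Pairing: "run f p x a \<Longrightarrow> run f q x b \<Longrightarrow> run f (Pairing p q) x (prod_encode (a, b))"
| run_Comp: "run f q x a \<Longrightarrow> run f p a y \<Longrightarrow> run f (Comp p q) x y"
| run_PrimRec_0: "run f p x y \<Longrightarrow> run f (PrimRec p q) (prod_encode (x, 0)) y"
| run_PrimRec_Suc:
    "run f (PrimRec p q) (prod_encode (x, n)) a \<Longrightarrow>
     run f q (prod_encode (x, prod_encode (n, a))) y \<Longrightarrow>
     run f (PrimRec p q) (prod_encode (x, Suc n)) y"
| run_Mu:
    "run f p (prod_encode (x, n)) 0 \<Longrightarrow>
     (\<And>m. m < n \<Longrightarrow> \<exists>k. run f p (prod_encode (x, m)) (Suc k)) \<Longrightarrow>
     run f (Mu p) x n"

text \<open>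
  The Goedel numbering has to be effective, since indices of functionals occur as values of
  functions in the implication of mass problems below.
\<close>

primrec code :: "prog \<Rightarrow> nat" where
  "code Zero = prod_encode (0, 0)"
| "code Succ = prod_encode (1, 0)"
| "code Fst = prod_encode (2, 0)"
| "code Snd = prod_encode (3, 0)"
| "code Oracle = prod_encode (4, 0)"
| "code (Pairing p q) = prod_encode (5, prod_encode (code p, code q))"
| "code (Comp p q) = prod_encode (6, prod_encode (code p, code q))"
| "code (PrimRec p q) = prod_encode (7, prod_encode (code p, code q))"
| "code (Mu p) = prod_encode (8, code p)"

text \<open>
  The graph of the \<open>z\<close>-th Turing functional: \<open>Phi z f g\<close> means that \<open>\<Phi>\<^sub>z(f)\<close> is defined (that is,
  total) and equal to \<open>g\<close>. If \<open>z\<close> is not the code of a program, \<open>\<Phi>\<^sub>z\<close> is nowhere defined.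
\<close>

definition Phi :: "nat \<Rightarrow> (nat \<Rightarrow> nat) \<Rightarrow> (nat \<Rightarrow> nat) \<Rightarrow> bool" where
  "Phi z f g \<longleftrightarrow> (\<exists>p. code p = z \<and> (\<forall>x. run f p x (g x)))"

lemma run_functional: "run f p x y \<Longrightarrow> run f p x y' \<Longrightarrow> y = y'"
proof (induction arbitrary: y' rule: run.induct)
  case (run_Zero x)
  then show ?case by cases auto
next
  case (run_Succ x)
  then show ?case by cases auto
next
  case (run_Fst x)
  then show ?case by cases auto
next
  case (run_Snd x)
  then show ?case by cases auto
next
  case (run_Oracle x)
  then show ?case by cases auto
next
  case (run_Pairing p x a q b)
  from run_Pairing.prems show ?case
  proof cases
    case (run_Pairing a' b')
    then show ?thesis using run_Pairing.IH by blast
  qed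
next
  case (run_Comp q x a p y)
  from run_Comp.prems show ?case
  proof cases
    case (run_Comp a')
    then show ?thesis using run_Comp.IH by blast
  qed
next
  case (run_PrimRec_0 p x y q)
  from run_PrimRec_0.prems show ?case
    by cases (auto intro: run_PrimRec_0.IH)
next
  case (run_PrimRec_Suc p q x n a y)
  from run_PrimRec_Suc.prems obtain a' where
    "run f (PrimRec p q) (prod_encode (x, n)) a'"
    "run f q (prod_encode (x, prod_encode (n, a'))) y'"
    by cases auto
  then show ?case using run_PrimRec_Suc.IH by blast
next
  case (run_Mu p x n)
  from run_Mu.prems have y': "run f p (prod_encode (x, y')) 0"
      "\<And>m. m < y' \<Longrightarrow> \<exists>k. run f p (prod_encode (x, m)) (Suc k)"
    by (cases; simp)+
  have "\<not> n < y'" using y'(2)[of n] run_Mu.IH(1) by blast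
  moreover have "\<not> y' < n" using y'(1) run_Mu.IH(2)[of y'] by blast
  ultimately show ?case by simp
qed

lemma code_inject: "code p = code q \<longleftrightarrow> p = q"
proof (induction p arbitrary: q)
  case Zero
  show ?case by (cases q) simp_all
next
  case Succ
  show ?case by (cases q) simp_all
next
  case Fst
  show ?case by (cases q) simp_all
next
  case Snd
  show ?case by (cases q) simp_all
next
  case Oracle
  show ?case by (cases q) simp_all
next
  case (Pairing p p')
  then show ?case by (cases q) simp_all
next
  case (Comp p p')
  then show ?case by (cases q) simp_all
next
  case (PrimRec p p')
  then show ?case by (cases q) simp_all
next
  case (Mu p)
  then show ?case by (cases q) simp_all
qed

lemma Phi_functional: "Phi z f g \<Longrightarrow> Phi z f h \<Longrightarrow> g = h"
  unfolding Phi_def by (auto simp: code_inject fun_eq_iff intro: run_functional)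

section \<open>Mass problems and Medvedev degrees\<close>

type_synonym mass_problem = "(nat \<Rightarrow> nat) set"

definition medvedev_le :: "mass_problem \<Rightarrow> mass_problem \<Rightarrow> bool" (infix "\<le>\<^sub>M" 50) where
  "A \<le>\<^sub>M B \<longleftrightarrow> (\<exists>z. \<forall>f\<in>B. \<exists>g\<in>A. Phi z f g)"

definition medvedev_equiv :: "mass_problem \<Rightarrow> mass_problem \<Rightarrow> bool" (infix "\<equiv>\<^sub>M" 50) where
  "A \<equiv>\<^sub>M B \<longleftrightarrow> A \<le>\<^sub>M B \<and> B \<le>\<^sub>M A"

primrec subst_oracle :: "prog \<Rightarrow> prog \<Rightarrow> prog" where
  "subst_oracle r Zero = Zero"
| "subst_oracle r Succ = Succ"
| "subst_oracle r Fst = Fst"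
| "subst_oracle r Snd = Snd"
| "subst_oracle r Oracle = r"
| "subst_oracle r (Pairing p q) = Pairing (subst_oracle r p) (subst_oracle r q)"
| "subst_oracle r (Comp p q) = Comp (subst_oracle r p) (subst_oracle r q)"
| "subst_oracle r (PrimRec p q) = PrimRec (subst_oracle r p) (subst_oracle r q)"
| "subst_oracle r (Mu p) = Mu (subst_oracle r p)"

lemma run_subst_oracle:
  assumes "\<And>x. run f r x (g x)"
  shows "run g p x y \<Longrightarrow> run f (subst_oracle r p) x y"
proof (induction rule: run.induct)
  case (run_Mu p x n)
  show ?case unfolding subst_oracle.simps
    by (rule run.run_Mu) (use run_Mu.IH in blast)+
qed (simp_all add: assms run.intros run.run_PrimRec_Suc run.run_Comp)

lemma medvedev_le_iff_prog: "A \<le>\<^sub>M B \<longleftrightarrow> (\<exists>p. \<forall>f\<in>B. \<exists>g\<in>A. \<forall>x. run f p x (g x))"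
proof
  assume "A \<le>\<^sub>M B"
  then obtain z where z: "\<forall>f\<in>B. \<exists>g\<in>A. Phi z f g"
    unfolding medvedev_le_def by blast
  have "\<forall>f\<in>B. \<exists>g\<in>A. \<forall>x. run f (SOME p. code p = z) x (g x)"
  proof
    fix f assume "f \<in> B"
    then obtain g p where g: "g \<in> A" "code p = z" "\<forall>x. run f p x (g x)"
      using z unfolding Phi_def by blast
    moreover have "(SOME p. code p = z) = p"
      using g(2) by (intro some_equality) (auto simp: code_inject)
    ultimately show "\<exists>g\<in>A. \<forall>x. run f (SOME p. code p = z) x (g x)" by metis
  qed
  then show "\<exists>p. \<forall>f\<in>B. \<exists>g\<in>A. \<forall>x. run f p x (g x)" by (rule exI)
next
  assume "\<exists>p. \<forall>f\<in>B. \<exists>g\<in>A. \<forall>x. run f p x (g x)"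
  then show "A \<le>\<^sub>M B" unfolding medvedev_le_def Phi_def by blast
qed

lemma medvedev_le_refl: "A \<le>\<^sub>M A"
  unfolding medvedev_le_iff_prog using run_Oracle by blast

lemma medvedev_le_trans:
  assumes "A \<le>\<^sub>M B" and "B \<le>\<^sub>M C"
  shows "A \<le>\<^sub>M C"
proof -
  obtain p q where p: "\<forall>f\<in>B. \<exists>g\<in>A. \<forall>x. run f p x (g x)"
    and q: "\<forall>f\<in>C. \<exists>g\<in>B. \<forall>x. run f q x (g x)"
    using assms unfolding medvedev_le_iff_prog by blast
  have "\<forall>f\<in>C. \<exists>h\<in>A. \<forall>x. run f (subst_oracle q p) x (h x)"
    using p q run_subst_oracle by meson
  then show ?thesis unfolding medvedev_le_iff_prog by (rule exI)
qed

quotient_type mdegree = mass_problem / medvedev_equiv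
  morphisms mrep mdeg
  by (intro equivpI reflpI sympI transpI)
    (auto simp: medvedev_equiv_def intro: medvedev_le_refl medvedev_le_trans)

lift_definition mdeg_le :: "mdegree \<Rightarrow> mdegree \<Rightarrow> bool" is medvedev_le
  unfolding medvedev_equiv_def using medvedev_le_trans by blast

definition interleave :: "(nat \<Rightarrow> nat) \<Rightarrow> (nat \<Rightarrow> nat) \<Rightarrow> nat \<Rightarrow> nat" (infixr "\<oplus>" 65) where
  "f \<oplus> g = (\<lambda>n. if even n then f (n div 2) else g (n div 2))"

definition prepend :: "nat \<Rightarrow> (nat \<Rightarrow> nat) \<Rightarrow> nat \<Rightarrow> nat" where
  "prepend z f = case_nat z f"

definition mp_join :: "mass_problem \<Rightarrow> mass_problem \<Rightarrow> mass_problem" where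
  "mp_join A B = {f \<oplus> g | f g. f \<in> A \<and> g \<in> B}"

definition mp_meet :: "mass_problem \<Rightarrow> mass_problem \<Rightarrow> mass_problem" where
  "mp_meet A B = prepend 0 ` A \<union> prepend 1 ` B"

text \<open>
  The direction is the one for which the degree of \<open>mp_imp A B\<close> is the least \<open>c\<close> with
  \<open>deg A + c \<ge> deg B\<close>.
\<close>

definition mp_imp :: "mass_problem \<Rightarrow> mass_problem \<Rightarrow> mass_problem" where
  "mp_imp A B = {prepend z f | z f. \<forall>g\<in>A. \<exists>h\<in>B. Phi z (g \<oplus> f) h}"

section \<open>Brouwer algebras and their theories\<close>

record 'a brouwer =
  carrier :: "'a set"
  le :: "'a \<Rightarrow> 'a \<Rightarrow> bool"
  join :: "'a \<Rightarrow> 'a \<Rightarrow> 'a"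
  meet :: "'a \<Rightarrow> 'a \<Rightarrow> 'a"
  impl :: "'a \<Rightarrow> 'a \<Rightarrow> 'a"
  least :: 'a
  greatest :: 'a

text \<open>
  The operations on degrees are those of representatives; they do not depend on the representatives
  that \<^const>\<open>mrep\<close> chooses.
\<close>

definition medvedev :: "mdegree brouwer" where
  "medvedev = \<lparr>
     carrier = UNIV,
     le = mdeg_le,
     join = (\<lambda>a b. mdeg (mp_join (mrep a) (mrep b))),
     meet = (\<lambda>a b. mdeg (mp_meet (mrep a) (mrep b))),
     impl = (\<lambda>a b. mdeg (mp_imp (mrep a) (mrep b))),
     least = mdeg UNIV,
     greatest = mdeg {}\<rparr>"

definition initial_segment :: "'a brouwer \<Rightarrow> 'a \<Rightarrow> 'a brouwer" where
  "initial_segment L a = L\<lparr>carrier := {b \<in> carrier L. le L b a}, greatest := a\<rparr>"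

datatype form =
    Var nat
  | Neg form
  | And form form
  | Or form form
  | Imp form form

text \<open>The order is dual to that of Heyting algebras, so conjunction is join and disjunction is meet.\<close>

primrec eval :: "'a brouwer \<Rightarrow> (nat \<Rightarrow> 'a) \<Rightarrow> form \<Rightarrow> 'a" where
  "eval L v (Var n) = v n"
| "eval L v (Neg \<phi>) = impl L (eval L v \<phi>) (greatest L)"
| "eval L v (And \<phi> \<psi>) = join L (eval L v \<phi>) (eval L v \<psi>)"
| "eval L v (Or \<phi> \<psi>) = meet L (eval L v \<phi>) (eval L v \<psi>)"
| "eval L v (Imp \<phi> \<psi>) = impl L (eval L v \<phi>) (eval L v \<psi>)"

text \<open>
  Because of this dualization, truth is the least element: \<open>a \<rightarrow> b\<close> is the least element if and only
  if \<open>b \<le> a\<close>, and in particular \<open>p \<rightarrow> p\<close> always evaluates to the least element.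
\<close>

definition Th :: "'a brouwer \<Rightarrow> form set" where
  "Th L = {\<phi>. \<forall>v. (\<forall>n. v n \<in> carrier L) \<longrightarrow> eval L v \<phi> = least L}"

section \<open>Intermediate logics\<close>

inductive_set ipc_axioms :: "form set" where
  "Imp p (Imp q p) \<in> ipc_axioms"
| "Imp (Imp p (Imp q r)) (Imp (Imp p q) (Imp p r)) \<in> ipc_axioms"
| "Imp (And p q) p \<in> ipc_axioms"
| "Imp (And p q) q \<in> ipc_axioms"
| "Imp p (Imp q (And p q)) \<in> ipc_axioms"
| "Imp p (Or p q) \<in> ipc_axioms"
| "Imp q (Or p q) \<in> ipc_axioms"
| "Imp (Imp p r) (Imp (Imp q r) (Imp (Or p q) r)) \<in> ipc_axioms"
| "Imp (Imp p q) (Imp (Imp p (Neg q)) (Neg p)) \<in> ipc_axioms"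
| "Imp (Neg p) (Imp p q) \<in> ipc_axioms"

primrec subst :: "(nat \<Rightarrow> form) \<Rightarrow> form \<Rightarrow> form" where
  "subst \<sigma> (Var n) = \<sigma> n"
| "subst \<sigma> (Neg \<phi>) = Neg (subst \<sigma> \<phi>)"
| "subst \<sigma> (And \<phi> \<psi>) = And (subst \<sigma> \<phi>) (subst \<sigma> \<psi>)"
| "subst \<sigma> (Or \<phi> \<psi>) = Or (subst \<sigma> \<phi>) (subst \<sigma> \<psi>)"
| "subst \<sigma> (Imp \<phi> \<psi>) = Imp (subst \<sigma> \<phi>) (subst \<sigma> \<psi>)"

inductive_set ipc_plus :: "form set \<Rightarrow> form set" for \<Gamma> where
  ipc_axiom: "\<phi> \<in> ipc_axioms \<Longrightarrow> \<phi> \<in> ipc_plus \<Gamma>"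
| instance_of: "\<phi> \<in> \<Gamma> \<Longrightarrow> subst \<sigma> \<phi> \<in> ipc_plus \<Gamma>"
| modus_ponens: "Imp \<phi> \<psi> \<in> ipc_plus \<Gamma> \<Longrightarrow> \<phi> \<in> ipc_plus \<Gamma> \<Longrightarrow> \<psi> \<in> ipc_plus \<Gamma>"

definition Jan :: "form set" where
  "Jan = ipc_plus {Or (Neg (Var 0)) (Neg (Neg (Var 0)))}"

end

theory Submission
  imports Defs
begin

text \<open>
  Strictness: let \<open>f \<in> F\<close>, let \<open>b\<close> be generic, and let \<open>c\<close> differ from \<open>b\<close> exactly on the graph of \<open>f\<close>.
  Neither \<open>b\<close> nor \<open>c\<close> computes a member of \<open>F\<close>, but together they compute \<open>f\<close>. So the top of
  \<open>M/F\<close> is join reducible, which refutes weak excluded middle.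

  Inclusion: Jan is complete for the Kripke frames of all subsets of a finite set \<open>I\<close>, since every finite
  frame with a root and a top is a bounded morphic image of such a frame. To embed the upsets of this
  frame into \<open>M/F\<close>, take pairwise Turing incomparable functions \<open>f i\<close> that compute no member of \<open>F\<close>
  and let \<open>B i\<close> be the set of the functions not computable from \<open>f i\<close>. A world \<open>s \<subseteq> I\<close> corresponds to the
  meet of \<open>F\<close> and the \<open>B i\<close> with \<open>i \<notin> s\<close>; these meets are join prime relative to the degrees at
  hand, which makes the embedding preserve implication.

  Both parts rest on one density argument: if \<open>X\<close> is dense and \<open>F\<close> is closed, then \<open>X\<close> is of no help in
  computing members of \<open>F\<close>, as the computation can be run on finite conditions instead.
\<close>

section \<open>Computable functionals\<close>

text \<open>Implication in \<open>M/F\<close> is computed in the full lattice of degrees, so the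
  embedding has to control \<open>b \<le> a + d\<close> for arbitrary degrees \<open>d\<close>, not
  only for those in its image. Primality is therefore proved against every \<open>d\<close>, with a
  side degree that absorbs the worlds not at issue: for a world \<open>t\<close> it is the set of
  functions below no \<open>f i\<close> with \<open>i \<in> t\<close>. This set is dense because it
  is closed under Turing equivalence. Cancelling it is the density argument itself for
  \<open>F\<close>, and a variant of that argument for the meets of the \<open>B i\<close>. As no
  \<open>f i\<close> computes a member of \<open>F\<close>, each \<open>B i\<close> contains
  \<open>F\<close>; so the \<open>B i\<close> absorb \<open>F\<close> in every meet except at the
  top world \<open>s = I\<close>, which thereby gets the top degree.

  Closedness of \<open>F\<close> enters in one way: a function all of whose initial segments extend
  to members of \<open>F\<close> is a member. Finite conditions are handled through derivations,
  finite lists of claims about computations. They can be checked before an oracle is fixed, they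
  yield a universal program, and their consistency with a half-known oracle is decidable.\<close>

definition computable :: "((nat \<Rightarrow> nat) \<Rightarrow> nat \<Rightarrow> nat) \<Rightarrow> bool" where
  "computable F \<longleftrightarrow> (\<exists>p. \<forall>f x. run f p x (F f x))"

definition decidable :: "((nat \<Rightarrow> nat) \<Rightarrow> nat \<Rightarrow> bool) \<Rightarrow> bool" where
  "decidable P \<longleftrightarrow> computable (\<lambda>f e. of_bool (P f e))"

abbreviation pr1 :: "nat \<Rightarrow> nat" where "pr1 x \<equiv> fst (prod_decode x)"
abbreviation pr2 :: "nat \<Rightarrow> nat" where "pr2 x \<equiv> snd (prod_decode x)"
abbreviation pair :: "nat \<Rightarrow> nat \<Rightarrow> nat" where "pair x y \<equiv> prod_encode (x, y)"

lemma pair_pr [simp]: "pair (pr1 x) (pr2 x) = x"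
  by simp

lemma computableI: "(\<And>f x. run f p x (F f x)) \<Longrightarrow> computable F"
  unfolding computable_def by blast

lemma computable_id: "computable (\<lambda>f e. e)"
proof (rule computableI)
  show "run f (Pairing Fst Snd) x x" for f x
    using run_Pairing[OF run_Fst run_Snd] by simp
qed

lemma computable_comp:
  assumes "computable F" and "computable G"
  shows "computable (\<lambda>f e. F f (G f e))"
  using assms unfolding computable_def by (metis run_Comp)

lemma computable_Suc: "computable G \<Longrightarrow> computable (\<lambda>f e. Suc (G f e))"
  by (rule computable_comp[where F = "\<lambda>f. Suc"]) (auto intro: computableI run_Succ)

lemma computable_const: "computable (\<lambda>f e. c)"
  by (induction c) (auto intro: computableI run_Zero computable_Suc)

lemma computable_oracle: "computable G \<Longrightarrow> computable (\<lambda>f e. f (G f e))"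
  by (rule computable_comp[where F = "\<lambda>f. f"]) (auto intro: computableI run_Oracle)

lemma computable_pr1: "computable G \<Longrightarrow> computable (\<lambda>f e. pr1 (G f e))"
  by (rule computable_comp[where F = "\<lambda>f. pr1"]) (auto intro: computableI run_Fst)

lemma computable_pr2: "computable G \<Longrightarrow> computable (\<lambda>f e. pr2 (G f e))"
  by (rule computable_comp[where F = "\<lambda>f. pr2"]) (auto intro: computableI run_Snd)

lemma computable_pair:
  "computable F \<Longrightarrow> computable G \<Longrightarrow> computable (\<lambda>f e. pair (F f e) (G f e))"
  unfolding computable_def by (metis run_Pairing)

lemma run_PrimRec_rec:
  assumes "\<And>x. run f p x (A x)" and "\<And>x. run f q x (B x)"
  shows "run f (PrimRec p q) (pair x n) (rec_nat (A x) (\<lambda>n a. B (pair x (pair n a))) n)"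
proof (induction n)
  case 0
  show ?case using run_PrimRec_0 assms(1) by simp
next
  case (Suc n)
  show ?case using run_PrimRec_Suc[OF Suc assms(2)] by simp
qed

text \<open>The parameter of the recursion is the input \<open>e\<close> itself, so base, step and
  bound may all refer to it. The nested projections match the argument that \<open>PrimRec\<close>
  hands to its step program.\<close>

lemma computable_rec:
  assumes A: "computable A"
    and B: "computable (\<lambda>f e. B f (pr1 e) (pr1 (pr2 e)) (pr2 (pr2 e)))"
    and N: "computable N"
  shows "computable (\<lambda>f e. rec_nat (A f e) (B f e) (N f e))"
proof -
  obtain p q where p: "\<And>f x. run f p x (A f x)"
    and q: "\<And>f e. run f q e (B f (pr1 e) (pr1 (pr2 e)) (pr2 (pr2 e)))"
    using A B unfolding computable_def by blast
  have "computable (\<lambda>f e. rec_nat (A f (pr1 e)) (B f (pr1 e)) (pr2 e))"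
  proof (rule computableI)
    show "run f (PrimRec p q) x (rec_nat (A f (pr1 x)) (B f (pr1 x)) (pr2 x))" for f x
      using run_PrimRec_rec[OF p q, of f "pr1 x" "pr2 x"] by simp
  qed
  from computable_comp[OF this computable_pair[OF computable_id N]] show ?thesis
    by simp
qed

lemma computable_if:
  assumes "decidable P" and A: "computable A" and B: "computable B"
  shows "computable (\<lambda>f e. if P f e then A f e else B f e)"
proof -
  \<comment> \<open>The truth value serves as the length, 0 or 1, of a recursion.\<close>
  have "computable (\<lambda>f e. rec_nat (B f e) (\<lambda>_ _. A f e) (of_bool (P f e)))"
    using assms(1) unfolding decidable_def
    by (intro computable_rec computable_comp[OF A] B computable_pr1 computable_id)
  moreover have "(\<lambda>f e. if P f e then A f e else B f e) =
      (\<lambda>f e. rec_nat (B f e) (\<lambda>_ _. A f e) (of_bool (P f e)))"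
    by (auto simp: fun_eq_iff)
  ultimately show ?thesis by simp
qed

lemma decidable_const: "decidable (\<lambda>f e. c)"
  unfolding decidable_def by (rule computable_const)

lemma decidable_if:
  "decidable P \<Longrightarrow> decidable Q \<Longrightarrow> decidable R \<Longrightarrow>
    decidable (\<lambda>f e. if P f e then Q f e else R f e)"
  using computable_if[of P "\<lambda>f e. of_bool (Q f e)" "\<lambda>f e. of_bool (R f e)"]
  unfolding decidable_def by (simp only: if_distrib[of of_bool])

lemma decidable_cong: "decidable P \<Longrightarrow> (\<And>f e. P f e = Q f e) \<Longrightarrow> decidable Q"
  by (rule back_subst[where P = decidable], assumption, intro ext)

lemma decidable_not: "decidable P \<Longrightarrow> decidable (\<lambda>f e. \<not> P f e)"
  by (rule decidable_cong[OF decidable_if[OF _ decidable_const[of False] decidable_const[of True]]]) auto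

lemma decidable_conj: "decidable P \<Longrightarrow> decidable Q \<Longrightarrow> decidable (\<lambda>f e. P f e \<and> Q f e)"
  by (rule decidable_cong[OF decidable_if[OF _ _ decidable_const[of False], of P Q]]) auto

lemma decidable_disj:
  assumes "decidable P" and "decidable Q"
  shows "decidable (\<lambda>f e. P f e \<or> Q f e)"
proof -
  have "decidable (\<lambda>f e. \<not> (\<not> P f e \<and> \<not> Q f e))"
    by (intro decidable_not decidable_conj assms)
  then show ?thesis by simp
qed

lemma decidable_imp:
  assumes "decidable P" and "decidable Q"
  shows "decidable (\<lambda>f e. P f e \<longrightarrow> Q f e)"
  using decidable_disj[OF decidable_not[OF assms(1)] assms(2)] by (simp only: imp_conv_disj)

lemma computable_minus:
  assumes "computable F" and "computable G"
  shows "computable (\<lambda>f e. F f e - G f e)"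
proof -
  \<comment> \<open>The step receives the counter before it is increased, so returning it gives the
    predecessor; iterating this gives truncated subtraction.\<close>
  have "rec_nat 0 (\<lambda>n a. n) k = k - 1" for k :: nat
    by (cases k) auto
  moreover have "computable (\<lambda>f e. rec_nat 0 (\<lambda>n a. n) e)"
    by (intro computable_rec computable_const computable_id computable_pr1 computable_pr2)
  ultimately have pred: "computable (\<lambda>f e. e - 1)" by simp
  have "rec_nat m (\<lambda>_ a. a - 1) k = m - k" for m k :: nat
    by (induction k) auto
  moreover have "computable (\<lambda>f e. rec_nat (F f e) (\<lambda>_ a. a - 1) (G f e))"
    by (rule computable_rec[OF assms(1) _ assms(2)], rule computable_comp[OF pred])
      (intro computable_id computable_pr2)
  ultimately show ?thesis by (simp only:)
qed

lemma decidable_is_0: "computable F \<Longrightarrow> decidable (\<lambda>f e. F f e = 0)"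
proof -
  assume F: "computable F"
  have "of_bool (k = 0) = 1 - k" for k :: nat by simp
  then show ?thesis
    unfolding decidable_def using computable_minus[OF computable_const F, of 1] by simp
qed

lemma decidable_le: "computable F \<Longrightarrow> computable G \<Longrightarrow> decidable (\<lambda>f e. F f e \<le> G f e)"
  using decidable_is_0[OF computable_minus, of F G] by simp

lemma decidable_less: "computable F \<Longrightarrow> computable G \<Longrightarrow> decidable (\<lambda>f e. F f e < G f e)"
  using decidable_not[OF decidable_le, of G F] by (simp add: not_le)

lemma decidable_eq:
  assumes "computable F" and "computable G"
  shows "decidable (\<lambda>f e. F f e = G f e)"
  using decidable_conj[OF decidable_le[OF assms] decidable_le[OF assms(2,1)]]
  by (simp add: eq_iff)

lemma decidable_ball_less:
  assumes Q: "decidable (\<lambda>f e. Q f (pr1 e) (pr2 e))" and N: "computable N"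
  shows "decidable (\<lambda>f e. \<forall>i<N f e. Q f e i)"
proof -
  have "rec_nat 1 (\<lambda>i a. if Q f e i then a else 0) n = (of_bool (\<forall>i<n. Q f e i) :: nat)" for f e n
    by (induction n) (auto simp: less_Suc_eq)
  moreover have "decidable (\<lambda>f e. Q f (pr1 e) (pr1 (pr2 e)))"
    using computable_comp[OF Q[unfolded decidable_def],
        of "\<lambda>f e. pair (pr1 e) (pr1 (pr2 e))"]
    unfolding decidable_def
    by (simp add: computable_pair computable_pr1 computable_pr2 computable_id)
  then have "computable (\<lambda>f e. rec_nat 1 (\<lambda>i a. if Q f e i then a else 0) (N f e))"
    by (intro computable_rec computable_if N computable_const computable_id computable_pr2)
  ultimately show ?thesis unfolding decidable_def by (simp only:)
qed

lemma decidable_bex_less: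
  assumes "decidable (\<lambda>f e. Q f (pr1 e) (pr2 e))" and "computable N"
  shows "decidable (\<lambda>f e. \<exists>i<N f e. Q f e i)"
proof -
  have "decidable (\<lambda>f e. \<not> (\<forall>i<N f e. \<not> Q f e i))"
    by (intro decidable_not decidable_ball_less assms)
  then show ?thesis by simp
qed

lemmas computable_intros =
  computable_const computable_id computable_pr1 computable_pr2 computable_pair computable_Suc
  computable_oracle computable_rec computable_if computable_minus
  decidable_const decidable_conj decidable_disj decidable_imp decidable_not decidable_if
  decidable_ball_less decidable_bex_less decidable_le decidable_less decidable_eq

lemma decidable_comp:
  assumes "decidable P" and "computable G"
  shows "decidable (\<lambda>f e. P f (G f e))"
  using assms computable_comp unfolding decidable_def by blast

text \<open>\<open>Mu\<close> looks for a zero, hence \<open>c\<close> tests the negation of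
  \<open>Q\<close>. Callers first exhibit some witness and then work with whichever one the search
  returns.\<close>

lemma search_program:
  assumes Q: "decidable (\<lambda>f e. Q f (pr1 e) (pr2 e))"
  shows "\<exists>p. \<forall>f x. (\<exists>n. Q f x n) \<longrightarrow> (\<exists>n. Q f x n \<and> run f p x n)"
proof -
  obtain c where c: "run f c e (of_bool (\<not> Q f (pr1 e) (pr2 e)))" for f e
    using decidable_not[OF Q] unfolding decidable_def computable_def by blast
  have "run f (Mu c) x (LEAST n. Q f x n)" if "\<exists>n. Q f x n" for f x
  proof (rule run_Mu)
    show "run f c (pair x (LEAST n. Q f x n)) 0"
      using c[of f "pair x (LEAST n. Q f x n)"] LeastI_ex[OF that] by simp
    show "\<exists>k. run f c (pair x m) (Suc k)" if "m < (LEAST n. Q f x n)" for m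
      using c[of f "pair x m"] not_less_Least[OF that] by auto
  qed
  then show ?thesis by (meson LeastI_ex)
qed

text \<open>Finitely many values of a possibly noncomputable function can be built into a program.
  This serves to change an oracle on an initial segment and to store finitely many indices.\<close>

lemma computable_finite_table:
  fixes g :: "nat \<Rightarrow> nat"
  shows "computable (\<lambda>f e. if e < n then g e else 0)"
proof (induction n)
  case 0
  show ?case by (simp add: computable_const)
next
  case (Suc n)
  have "(\<lambda>f e. if e < Suc n then g e else 0) =
      (\<lambda>(f :: nat \<Rightarrow> nat) e. if e = n then g n else if e < n then g e else 0)"
    by (auto simp: fun_eq_iff less_Suc_eq)
  moreover have "decidable (\<lambda>f e. e = n)"
    by (intro computable_intros)
  ultimately show ?case
    using computable_if[OF _ computable_const Suc, of "\<lambda>f e. e = n" "g n"] by (simp only:)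
qed

section \<open>Derivations of computations\<close>

abbreviation fact_prog :: "nat \<Rightarrow> nat" where "fact_prog c \<equiv> pr1 c"
abbreviation fact_arg :: "nat \<Rightarrow> nat" where "fact_arg c \<equiv> pr1 (pr2 c)"
abbreviation fact_val :: "nat \<Rightarrow> nat" where "fact_val c \<equiv> pr2 (pr2 c)"
abbreviation fact_of :: "nat \<Rightarrow> nat \<Rightarrow> nat \<Rightarrow> nat" where "fact_of z x y \<equiv> pair z (pair x y)"

text \<open>
  A fact \<open>c\<close> claims that the program with code \<open>fact_prog c\<close> maps \<open>fact_arg c\<close> to \<open>fact_val c\<close>. It is
  justified by the facts in \<open>K\<close> if it follows from them by one rule of \<^const>\<open>run\<close>; claims about the
  oracle count as justified, so that derivations can be judged before the oracle is known.
\<close>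

definition justified :: "nat set \<Rightarrow> nat \<Rightarrow> bool" where
  "justified K c \<longleftrightarrow>
    fact_prog c = code Zero \<and> fact_val c = 0 \<or>
    fact_prog c = code Succ \<and> fact_val c = Suc (fact_arg c) \<or>
    fact_prog c = code Fst \<and> fact_val c = pr1 (fact_arg c) \<or>
    fact_prog c = code Snd \<and> fact_val c = pr2 (fact_arg c) \<or>
    fact_prog c = code Oracle \<or>
    pr1 (fact_prog c) = 5 \<and>
      fact_of (pr1 (pr2 (fact_prog c))) (fact_arg c) (pr1 (fact_val c)) \<in> K \<and>
      fact_of (pr2 (pr2 (fact_prog c))) (fact_arg c) (pr2 (fact_val c)) \<in> K \<or>
    pr1 (fact_prog c) = 6 \<and>
      (\<exists>b\<in>K. fact_prog b = pr2 (pr2 (fact_prog c)) \<and> fact_arg b = fact_arg c \<and>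
        fact_of (pr1 (pr2 (fact_prog c))) (fact_val b) (fact_val c) \<in> K) \<or>
    pr1 (fact_prog c) = 7 \<and> pr2 (fact_arg c) = 0 \<and>
      fact_of (pr1 (pr2 (fact_prog c))) (pr1 (fact_arg c)) (fact_val c) \<in> K \<or>
    pr1 (fact_prog c) = 7 \<and> pr2 (fact_arg c) \<noteq> 0 \<and>
      (\<exists>b\<in>K. fact_prog b = fact_prog c \<and>
        fact_arg b = pair (pr1 (fact_arg c)) (pr2 (fact_arg c) - 1) \<and>
        fact_of (pr2 (pr2 (fact_prog c)))
          (pair (pr1 (fact_arg c)) (pair (pr2 (fact_arg c) - 1) (fact_val b))) (fact_val c) \<in> K) \<or>
    pr1 (fact_prog c) = 8 \<and>
      fact_of (pr2 (fact_prog c)) (pair (fact_arg c) (fact_val c)) 0 \<in> K \<and>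
      (\<forall>m<fact_val c. \<exists>b\<in>K. fact_prog b = pr2 (fact_prog c) \<and>
        fact_arg b = pair (fact_arg c) m \<and> fact_val b \<noteq> 0)"

definition derivation :: "nat list \<Rightarrow> bool" where
  "derivation cs \<longleftrightarrow> (\<forall>i<length cs. justified (set (take i cs)) (cs ! i))"

definition obeys :: "(nat \<Rightarrow> nat) \<Rightarrow> nat list \<Rightarrow> bool" where
  "obeys f cs \<longleftrightarrow> (\<forall>c\<in>set cs. fact_prog c = code Oracle \<longrightarrow> f (fact_arg c) = fact_val c)"

lemma justified_mono:
  assumes "justified K c" and "K \<subseteq> K'"
  shows "justified K' c"
  using assms(1) unfolding justified_def by (elim disj_forward) (use assms(2) in blast)+

lemma derivation_Nil: "derivation []"
  by (simp add: derivation_def)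

lemma derivation_append:
  assumes "derivation xs" and "derivation ys"
  shows "derivation (xs @ ys)"
  unfolding derivation_def
proof (intro allI impI)
  fix i assume i: "i < length (xs @ ys)"
  show "justified (set (take i (xs @ ys))) ((xs @ ys) ! i)"
  proof (cases "i < length xs")
    case True
    then show ?thesis using assms(1) by (simp add: derivation_def nth_append)
  next
    case False
    then have "justified (set (take (i - length xs) ys)) (ys ! (i - length xs))"
      using assms(2) i by (simp add: derivation_def)
    then show ?thesis
      using False by (auto simp: nth_append elim: justified_mono)
  qed
qed

lemma derivation_concat: "(\<And>xs. xs \<in> set xss \<Longrightarrow> derivation xs) \<Longrightarrow> derivation (concat xss)"
  by (induction xss) (auto intro: derivation_Nil derivation_append)

lemma derivation_snoc: "derivation xs \<Longrightarrow> justified (set xs) c \<Longrightarrow> derivation (xs @ [c])"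
  by (auto simp: derivation_def nth_append less_Suc_eq)

lemma obeys_append: "obeys f (xs @ ys) \<longleftrightarrow> obeys f xs \<and> obeys f ys"
  by (auto simp: obeys_def)

lemma obeys_concat: "obeys f (concat xss) \<longleftrightarrow> (\<forall>xs\<in>set xss. obeys f xs)"
  by (auto simp: obeys_def)

lemma obeys_snoc:
  "obeys f xs \<Longrightarrow> (fact_prog c = code Oracle \<Longrightarrow> f (fact_arg c) = fact_val c) \<Longrightarrow> obeys f (xs @ [c])"
  by (auto simp: obeys_def)

lemma derivation_leaf:
  assumes "justified {} c" and "fact_prog c = code Oracle \<Longrightarrow> f (fact_arg c) = fact_val c"
  shows "\<exists>cs. derivation cs \<and> obeys f cs \<and> c \<in> set cs"
  using assms by (intro exI[of _ "[c]"]) (auto simp: derivation_def obeys_def)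

text \<open>One rule, read backwards. Trusting \<open>K\<close> on facts about actual codes is
  enough, because the components of the code of a program are codes of its subprograms.\<close>

lemma run_if_justified:
  assumes K: "\<And>p x y. fact_of (code p) x y \<in> K \<Longrightarrow> run f p x y"
    and "justified K (fact_of (code p) x y)"
    and "p = Oracle \<Longrightarrow> f x = y"
  shows "run f p x y"
proof (cases p)
  case (Pairing q r)
  then have "run f q x (pr1 y)" "run f r x (pr2 y)"
    using assms(2) K by (auto simp: justified_def)
  from run_Pairing[OF this] show ?thesis using Pairing by simp
next
  case (Comp q r)
  then obtain b where b: "b \<in> K" "fact_prog b = code r" "fact_arg b = x"
      and q: "fact_of (code q) (fact_val b) y \<in> K"
    using assms(2) by (auto simp: justified_def)
  have "fact_of (code r) x (fact_val b) \<in> K"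
    using b by (metis pair_pr)
  then show ?thesis using run_Comp K q Comp by blast
next
  case (PrimRec q r)
  show ?thesis
  proof (cases "pr2 x")
    case 0
    then have "run f q (pr1 x) y"
      using assms(2) K PrimRec by (auto simp: justified_def)
    from run_PrimRec_0[OF this] show ?thesis
      using PrimRec 0 by (metis pair_pr)
  next
    case (Suc n)
    then obtain b where b: "b \<in> K" "fact_prog b = code p" "fact_arg b = pair (pr1 x) n"
        and r: "fact_of (code r) (pair (pr1 x) (pair n (fact_val b))) y \<in> K"
      using assms(2) PrimRec by (auto simp: justified_def)
    have "fact_of (code p) (pair (pr1 x) n) (fact_val b) \<in> K"
      using b by (metis pair_pr)
    from run_PrimRec_Suc[OF K[OF this, unfolded PrimRec] K[OF r]] show ?thesis
      using PrimRec Suc by (metis pair_pr)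
  qed
next
  case (Mu q)
  then have "fact_of (code q) (pair x y) 0 \<in> K"
      and *: "\<And>m. m < y \<Longrightarrow> \<exists>b\<in>K. fact_prog b = code q \<and> fact_arg b = pair x m \<and> fact_val b \<noteq> 0"
    using assms(2) by (auto simp: justified_def)
  moreover have "\<exists>k. run f q (pair x m) (Suc k)" if m: "m < y" for m
  proof -
    obtain b where b: "b \<in> K" "fact_prog b = code q" "fact_arg b = pair x m" "fact_val b \<noteq> 0"
      using *[OF m] by blast
    have "fact_of (code q) (pair x m) (fact_val b) \<in> K"
      using b by (metis pair_pr)
    from K[OF this] show ?thesis
      using b(4) not0_implies_Suc by metis
  qed
  ultimately show ?thesis using run_Mu K Mu by blast
qed (use assms in \<open>auto simp: justified_def intro: run.intros run_Oracle\<close>)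

lemma run_if_derivation:
  assumes cs: "derivation cs" "obeys f cs" and "fact_of (code p) x y \<in> set cs"
  shows "run f p x y"
proof -
  have "cs ! i = fact_of (code p) x y \<Longrightarrow> run f p x y" if "i < length cs" for i p x y
    using that
  proof (induction i arbitrary: p x y rule: less_induct)
    case (less i)
    show ?case
    proof (rule run_if_justified[where K = "set (take i cs)"])
      fix q u v assume "fact_of (code q) u v \<in> set (take i cs)"
      then obtain j where "j < i" "cs ! j = fact_of (code q) u v"
        by (auto simp: in_set_conv_nth)
      then show "run f q u v"
        using less.IH less.prems(2) by auto
    next
      show "justified (set (take i cs)) (fact_of (code p) x y)"
        using cs(1) less.prems by (auto simp: derivation_def)
      show "f x = y" if "p = Oracle"
      proof -
        have "fact_of (code p) x y \<in> set cs"
          using less.prems by (metis nth_mem)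
        then show ?thesis using cs(2) that by (auto simp: obeys_def)
      qed
    qed
  qed
  then show ?thesis using assms(3) by (metis in_set_conv_nth)
qed

lemma derivation_if_run:
  "run f p x y \<Longrightarrow> \<exists>cs. derivation cs \<and> obeys f cs \<and> fact_of (code p) x y \<in> set cs"
proof (induction rule: run.induct)
  case (run_Pairing p x a q b)
  then obtain xs ys where
    "derivation xs" "obeys f xs" "fact_of (code p) x a \<in> set xs"
    "derivation ys" "obeys f ys" "fact_of (code q) x b \<in> set ys" by blast
  then have "derivation ((xs @ ys) @ [fact_of (code (Pairing p q)) x (pair a b)])"
      "obeys f ((xs @ ys) @ [fact_of (code (Pairing p q)) x (pair a b)])"
    by (intro derivation_snoc obeys_snoc derivation_append; simp add: justified_def obeys_append)+
  then show ?case by (metis in_set_conv_decomp)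
next
  case (run_Comp q x a p y)
  then obtain xs ys where *:
    "derivation xs" "obeys f xs" "fact_of (code q) x a \<in> set xs"
    "derivation ys" "obeys f ys" "fact_of (code p) a y \<in> set ys" by blast
  have "\<exists>b\<in>set (xs @ ys). fact_prog b = code q \<and> fact_arg b = x \<and>
      fact_of (code p) (fact_val b) y \<in> set (xs @ ys)"
    by (rule bexI[where x = "fact_of (code q) x a"]) (use * in auto)
  then have "justified (set (xs @ ys)) (fact_of (code (Comp p q)) x y)"
    by (simp add: justified_def)
  then have "derivation ((xs @ ys) @ [fact_of (code (Comp p q)) x y])"
      "obeys f ((xs @ ys) @ [fact_of (code (Comp p q)) x y])"
    using * by (intro derivation_snoc obeys_snoc derivation_append; simp add: obeys_append)+
  then show ?case by (metis in_set_conv_decomp)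
next
  case (run_PrimRec_0 p x y q)
  then obtain xs where
    "derivation xs" "obeys f xs" "fact_of (code p) x y \<in> set xs" by blast
  then have "derivation (xs @ [fact_of (code (PrimRec p q)) (pair x 0) y])"
      "obeys f (xs @ [fact_of (code (PrimRec p q)) (pair x 0) y])"
    by (intro derivation_snoc obeys_snoc; simp add: justified_def)+
  then show ?case by (metis in_set_conv_decomp)
next
  case (run_PrimRec_Suc p q x n a y)
  let ?r = "PrimRec p q"
  from run_PrimRec_Suc obtain xs ys where *:
    "derivation xs" "obeys f xs" "fact_of (code ?r) (pair x n) a \<in> set xs"
    "derivation ys" "obeys f ys" "fact_of (code q) (pair x (pair n a)) y \<in> set ys" by blast
  have "\<exists>b\<in>set (xs @ ys). fact_prog b = code ?r \<and> fact_arg b = pair x n \<and>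
      fact_of (code q) (pair x (pair n (fact_val b))) y \<in> set (xs @ ys)"
    by (rule bexI[where x = "fact_of (code ?r) (pair x n) a"]) (use * in auto)
  then have "justified (set (xs @ ys)) (fact_of (code ?r) (pair x (Suc n)) y)"
    by (simp add: justified_def)
  then have "derivation ((xs @ ys) @ [fact_of (code ?r) (pair x (Suc n)) y])"
      "obeys f ((xs @ ys) @ [fact_of (code ?r) (pair x (Suc n)) y])"
    using * by (intro derivation_snoc obeys_snoc derivation_append; simp add: obeys_append)+
  then show ?case by (metis in_set_conv_decomp)
next
  case (run_Mu p x n)
  \<comment> \<open>Each unsuccessful test \<open>m < n\<close> has its own derivation; these
    finitely many are chosen at once and concatenated.\<close>
  then have "\<forall>m. \<exists>cs. m < n \<longrightarrow> (\<exists>k. derivation cs \<and> obeys f cs \<and>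
      fact_of (code p) (pair x m) (Suc k) \<in> set cs)" by blast
  then obtain g where g: "\<And>m. m < n \<Longrightarrow> \<exists>k. derivation (g m) \<and> obeys f (g m) \<and>
      fact_of (code p) (pair x m) (Suc k) \<in> set (g m)" by metis
  obtain xs where xs: "derivation xs" "obeys f xs" "fact_of (code p) (pair x n) 0 \<in> set xs"
    using run_Mu by blast
  define ys where "ys = xs @ concat (map g [0..<n])"
  have ys: "derivation ys" "obeys f ys"
    using xs g unfolding ys_def
    by (auto simp: obeys_append obeys_concat intro!: derivation_append derivation_concat)
  have "\<exists>b\<in>set ys. fact_prog b = code p \<and> fact_arg b = pair x m \<and> fact_val b \<noteq> 0"
    if m: "m < n" for m
  proof -
    obtain k where "fact_of (code p) (pair x m) (Suc k) \<in> set (g m)" using g[OF m] by blast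
    then have "fact_of (code p) (pair x m) (Suc k) \<in> set ys"
      using m unfolding ys_def by auto
    then show ?thesis by (rule bexI[rotated]) simp
  qed
  then have "justified (set ys) (fact_of (code (Mu p)) x n)"
    using xs(3) by (simp add: justified_def ys_def)
  then have "derivation (ys @ [fact_of (code (Mu p)) x n])"
      "obeys f (ys @ [fact_of (code (Mu p)) x n])"
    using ys by (intro derivation_snoc obeys_snoc; simp)+
  then show ?case by (metis in_set_conv_decomp)
qed (rule derivation_leaf; simp add: justified_def)+

theorem run_iff_derivation:
  "run f p x y \<longleftrightarrow> (\<exists>cs. derivation cs \<and> obeys f cs \<and> fact_of (code p) x y \<in> set cs)"
  using run_if_derivation derivation_if_run by blast

definition agree :: "nat \<Rightarrow> (nat \<Rightarrow> nat) \<Rightarrow> (nat \<Rightarrow> nat) \<Rightarrow> bool" where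
  "agree n f g \<longleftrightarrow> (\<forall>k<n. f k = g k)"

text \<open>Finite use: the bound is read off the arguments in \<open>cs\<close>, so it serves all
  oracles at once.\<close>

lemma finite_obeys_agree:
  obtains n where "\<And>f g. obeys f cs \<Longrightarrow> agree n f g \<Longrightarrow> obeys g cs"
proof
  show "obeys f cs \<Longrightarrow> agree (Suc (Max (fact_arg ` set cs))) f g \<Longrightarrow> obeys g cs" for f g
    by (fastforce simp: obeys_def agree_def less_Suc_eq_le intro: Max_ge)
qed

lemma run_use:
  assumes "run f p x y"
  obtains n where "\<And>g. agree n f g \<Longrightarrow> run g p x y"
  using assms unfolding run_iff_derivation by (metis finite_obeys_agree)

subsection \<open>Derivations as numbers\<close>

definition entry :: "nat \<Rightarrow> nat \<Rightarrow> nat" where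
  "entry d i = pr1 ((pr2 ^^ i) d)"

text \<open>With the length stored beside the nested pairs, every number decodes to a list, so
  searches can run over all numbers, and a prefix is obtained by changing the length only.\<close>

definition facts :: "nat \<Rightarrow> nat list" where
  "facts D = map (entry (pr2 D)) [0..<pr1 D]"

lemma ex_facts: "\<exists>D. facts D = cs"
proof -
  have "\<exists>d. \<forall>i<length cs. entry d i = cs ! i"
  proof (induction cs)
    case (Cons c cs)
    then obtain d where d: "\<forall>i<length cs. entry d i = cs ! i" by blast
    have "entry (pair c d) i = (c # cs) ! i" if "i < length (c # cs)" for i
      using that d by (cases i) (auto simp: entry_def funpow_Suc_right simp del: funpow.simps)
    then show ?case by blast
  qed auto
  then obtain d where "\<forall>i<length cs. entry d i = cs ! i" by blast
  then have "facts (pair (length cs) d) = cs"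
    by (auto simp: facts_def intro: nth_equalityI)
  then show ?thesis by blast
qed

lemma computable_entry:
  assumes "computable D" and "computable I"
  shows "computable (\<lambda>f e. entry (D f e) (I f e))"
proof -
  have "(pr2 ^^ i) d = rec_nat d (\<lambda>_ a. pr2 a) i" for i d
    by (induction i) auto
  then show ?thesis
    unfolding entry_def by (simp only:) (intro computable_intros assms)
qed

lemma bex_facts_iff: "(\<exists>c\<in>set (facts D). P c) \<longleftrightarrow> (\<exists>i<pr1 D. P (entry (pr2 D) i))"
  by (auto simp: facts_def)

lemma decidable_bex_facts:
  assumes P: "decidable (\<lambda>f e. P f (pr1 e) (pr2 e))" and D: "computable D"
  shows "decidable (\<lambda>f e. \<exists>c\<in>set (facts (D f e)). P f e c)"
  unfolding bex_facts_iff
proof (rule decidable_bex_less)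
  show "decidable (\<lambda>f e. P f (pr1 e) (entry (pr2 (D f (pr1 e))) (pr2 e)))"
    using decidable_comp[OF P,
        of "\<lambda>f e. pair (pr1 e) (entry (pr2 (D f (pr1 e))) (pr2 e))"]
    by (simp add: computable_pair computable_entry computable_pr1 computable_pr2 computable_id
        computable_comp[OF D])
qed (intro computable_pr1 D)

lemma decidable_ball_facts:
  assumes "decidable (\<lambda>f e. P f (pr1 e) (pr2 e))" and "computable D"
  shows "decidable (\<lambda>f e. \<forall>c\<in>set (facts (D f e)). P f e c)"
proof -
  have "decidable (\<lambda>f e. \<not> (\<exists>c\<in>set (facts (D f e)). \<not> P f e c))"
    by (intro decidable_not decidable_bex_facts assms)
  then show ?thesis by simp
qed

lemma decidable_mem_facts:
  assumes C: "computable C" and "computable D"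
  shows "decidable (\<lambda>f e. C f e \<in> set (facts (D f e)))"
proof -
  have "decidable (\<lambda>f e. \<exists>c\<in>set (facts (D f e)). c = C f e)"
    by (intro decidable_bex_facts decidable_eq computable_comp[OF C] computable_intros assms)
  then show ?thesis by simp
qed

lemma decidable_justified:
  assumes "computable D" and "computable C"
  shows "decidable (\<lambda>f e. justified (set (facts (D f e))) (C f e))"
proof -
  have "decidable (\<lambda>f e. justified (set (facts (pr1 e))) (pr2 e))"
    unfolding justified_def
    by (intro computable_intros decidable_bex_facts decidable_mem_facts)
  from decidable_comp[OF this computable_pair[OF assms]] show ?thesis by simp
qed

lemma derivation_facts_iff:
  "derivation (facts D) \<longleftrightarrow> (\<forall>i<pr1 D. justified (set (facts (pair i (pr2 D)))) (entry (pr2 D) i))"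
  by (auto simp: derivation_def facts_def take_map)

lemma decidable_derivation:
  assumes D: "computable D"
  shows "decidable (\<lambda>f e. derivation (facts (D f e)))"
  unfolding derivation_facts_iff
  by (intro decidable_ball_less decidable_justified computable_entry computable_comp[OF D]
      computable_intros D)

section \<open>A universal program\<close>

text \<open>Search for a derivation; this evaluates programs whose code is only given as a number.\<close>

lemma universal_program:
  assumes Z: "computable Z" and F: "computable F"
  shows "\<exists>u. \<forall>f x p y. code p = Z f x \<longrightarrow> run (F f) p x y \<longrightarrow> run f u x y"
proof -
  define Q where "Q = (\<lambda>f x n. pr2 n \<in> set (facts (pr1 n)) \<and> derivation (facts (pr1 n)) \<and>
    obeys (F f) (facts (pr1 n)) \<and> fact_prog (pr2 n) = Z f x \<and> fact_arg (pr2 n) = x)"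
  have "decidable (\<lambda>f e. Q f (pr1 e) (pr2 e))"
    unfolding Q_def obeys_def
    by (intro computable_intros decidable_mem_facts decidable_derivation decidable_ball_facts
        computable_comp[OF Z] computable_comp[OF F])
  from search_program[OF this] obtain s where
    s: "\<And>f x. \<exists>n. Q f x n \<Longrightarrow> \<exists>n. Q f x n \<and> run f s x n" by metis
  obtain v where v: "\<And>f n. run f v n (fact_val (pr2 n))"
    using computable_pr2[OF computable_pr2[OF computable_pr2[OF computable_id]]]
    unfolding computable_def by auto
  have "run f (Comp v s) x y" if p: "code p = Z f x" "run (F f) p x y" for f x p y
  proof -
    obtain cs where cs: "derivation cs" "obeys (F f) cs" "fact_of (code p) x y \<in> set cs"
      using p(2) unfolding run_iff_derivation by blast
    obtain D where "facts D = cs"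
      using ex_facts by blast
    then have "Q f x (pair D (fact_of (code p) x y))"
      using cs p(1) by (simp add: Q_def)
    \<comment> \<open>The derivation found may differ from \<open>cs\<close>; soundness and
      uniqueness of outputs still force the value \<open>y\<close>.\<close>
    then obtain n where n: "Q f x n" "run f s x n"
      using s by blast
    have "fact_of (code p) x (fact_val (pr2 n)) \<in> set (facts (pr1 n))"
      using n(1) p(1) unfolding Q_def by (metis pair_pr)
    then have "run (F f) p x (fact_val (pr2 n))"
      using n(1) run_if_derivation unfolding Q_def by blast
    then have "fact_val (pr2 n) = y"
      using p(2) run_functional by blast
    then show ?thesis using run_Comp[OF n(2) v] by simp
  qed
  then show ?thesis by blast
qed

section \<open>Operations on mass problems\<close>

lemma medvedev_leI:
  "(\<And>f. f \<in> B \<Longrightarrow> \<exists>g\<in>A. \<forall>x. run f p x (g x)) \<Longrightarrow> A \<le>\<^sub>M B"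
  unfolding medvedev_le_iff_prog by blast

text \<open>Join, meet and implication select the program by the input, by a tag or by an index
  stored in the oracle. \<open>Z\<close> extracts its code, and \<open>F\<close> strips the stored
  number from the oracle.\<close>

lemma medvedev_leI_universal:
  assumes "computable Z" and "computable F"
    and *: "\<And>f. f \<in> B \<Longrightarrow> \<exists>g\<in>A. \<forall>x. \<exists>p. code p = Z f x \<and> run (F f) p x (g x)"
  shows "A \<le>\<^sub>M B"
proof -
  obtain u where "\<And>f x p y. code p = Z f x \<Longrightarrow> run (F f) p x y \<Longrightarrow> run f u x y"
    using universal_program[OF assms(1,2)] by blast
  with * show ?thesis by (intro medvedev_leI[where p = u]) meson
qed

lemma medvedev_leI_computable:
  assumes "computable F" and "\<And>f. f \<in> B \<Longrightarrow> F f \<in> A"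
  shows "A \<le>\<^sub>M B"
  using assms unfolding computable_def medvedev_le_iff_prog by metis

lemma medvedev_leE:
  assumes "A \<le>\<^sub>M B"
  obtains p where "\<And>f. f \<in> B \<Longrightarrow> \<exists>g\<in>A. \<forall>x. run f p x (g x)"
  using assms unfolding medvedev_le_iff_prog by blast

lemma medvedev_le_subset: "B \<subseteq> A \<Longrightarrow> A \<le>\<^sub>M B"
  by (rule medvedev_leI[where p = Oracle]) (auto intro: run_Oracle)

lemma computable_double: "computable F \<Longrightarrow> computable (\<lambda>f e. 2 * F f e)"
proof -
  assume F: "computable F"
  have "2 * n = rec_nat 0 (\<lambda>_ a. Suc (Suc a)) n" for n
    by (induction n) auto
  then show ?thesis by (simp only:) (intro computable_intros F)
qed

lemma computable_half: "computable F \<Longrightarrow> computable (\<lambda>f e. F f e div 2)"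
proof -
  assume F: "computable F"
  \<comment> \<open>The accumulator is the largest \<open>k\<close> up to the counter with
    \<open>2 * k \<le> n\<close>; the counter \<open>n\<close> is large enough.\<close>
  have *: "rec_nat 0 (\<lambda>k a. if 2 * Suc k \<le> n then Suc k else a) m = min m (n div 2)" for n m :: nat
    by (induction m) auto
  have "computable (\<lambda>f e. rec_nat 0 (\<lambda>k a. if 2 * Suc k \<le> e then Suc k else a) e)"
    by (intro computable_intros computable_double)
  then have "computable (\<lambda>f e. e div 2)"
    unfolding * by simp
  from computable_comp[OF this F] show ?thesis .
qed

lemma decidable_even:
  assumes "computable F"
  shows "decidable (\<lambda>f e. even (F f e))"
proof -
  have "decidable (\<lambda>f e. 2 * (F f e div 2) = F f e)"
    by (intro decidable_eq computable_double computable_half assms)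
  moreover have "2 * (n div 2) = n \<longleftrightarrow> even n" for n :: nat by presburger
  ultimately show ?thesis by simp
qed

lemma interleave_left [simp]: "(f \<oplus> g) (2 * n) = f n"
  and interleave_right [simp]: "(f \<oplus> g) (Suc (2 * n)) = g n"
  by (simp_all add: interleave_def)

lemma prepend_simps [simp]: "prepend z f 0 = z" "prepend z f (Suc n) = f n"
  by (simp_all add: prepend_def)

lemma computable_prepend: "computable (prepend z)"
proof -
  have "computable (\<lambda>f e. if e = 0 then z else f (e - 1))"
    by (intro computable_intros)
  moreover have "(\<lambda>f e. if e = 0 then z else f (e - 1)) = prepend z"
    by (auto simp: fun_eq_iff prepend_def split: nat.split)
  ultimately show ?thesis by simp
qed

lemma mp_join_le_iff: "mp_join A B \<le>\<^sub>M D \<longleftrightarrow> A \<le>\<^sub>M D \<and> B \<le>\<^sub>M D"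
proof (intro iffI conjI)
  have "A \<le>\<^sub>M mp_join A B"
  proof (rule medvedev_leI_computable)
    show "computable (\<lambda>f e. f (2 * e))"
      by (intro computable_intros computable_double)
  qed (auto simp: mp_join_def)
  then show "A \<le>\<^sub>M D" if "mp_join A B \<le>\<^sub>M D"
    using that medvedev_le_trans by blast
  have "B \<le>\<^sub>M mp_join A B"
  proof (rule medvedev_leI_computable)
    show "computable (\<lambda>f e. f (Suc (2 * e)))"
      by (intro computable_intros computable_double)
  qed (auto simp: mp_join_def)
  then show "B \<le>\<^sub>M D" if "mp_join A B \<le>\<^sub>M D"
    using that medvedev_le_trans by blast
next
  assume "A \<le>\<^sub>M D \<and> B \<le>\<^sub>M D"
  then obtain p q where
    p: "\<And>f. f \<in> D \<Longrightarrow> \<exists>g\<in>A. \<forall>x. run f p x (g x)" and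
    q: "\<And>f. f \<in> D \<Longrightarrow> \<exists>g\<in>B. \<forall>x. run f q x (g x)"
    using medvedev_leE by metis
  obtain h where h: "\<And>f x. run f h x (x div 2)"
    using computable_half[OF computable_id] unfolding computable_def by auto
  show "mp_join A B \<le>\<^sub>M D"
  proof (rule medvedev_leI_universal)
    show "computable (\<lambda>f e. if even e then code (Comp p h) else code (Comp q h))"
      by (intro computable_if decidable_even computable_id computable_const)
    show "computable (\<lambda>f e. f e)"
      by (intro computable_intros)
    fix f assume "f \<in> D"
    then obtain g g' where g: "g \<in> A" "\<And>x. run f p x (g x)" "g' \<in> B" "\<And>x. run f q x (g' x)"
      using p q by metis
    have "\<exists>r. code r = (if even x then code (Comp p h) else code (Comp q h)) \<and>
        run f r x ((g \<oplus> g') x)" for x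
      by (rule exI[where x = "if even x then Comp p h else Comp q h"])
        (auto simp: interleave_def intro: run_Comp h g)
    moreover have "g \<oplus> g' \<in> mp_join A B"
      using g by (auto simp: mp_join_def)
    ultimately show "\<exists>g\<in>mp_join A B. \<forall>x. \<exists>r. code r =
        (if even x then code (Comp p h) else code (Comp q h)) \<and> run (\<lambda>e. f e) r x (g x)"
      by blast
  qed
qed

lemma mp_join_upper: "A \<le>\<^sub>M mp_join A B" "B \<le>\<^sub>M mp_join A B"
  using mp_join_le_iff medvedev_le_refl by blast+

lemma le_mp_meet_iff: "D \<le>\<^sub>M mp_meet A B \<longleftrightarrow> D \<le>\<^sub>M A \<and> D \<le>\<^sub>M B"
proof (intro iffI conjI)
  have "mp_meet A B \<le>\<^sub>M A"
    by (rule medvedev_leI_computable[OF computable_prepend[of 0]]) (simp add: mp_meet_def)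
  then show "D \<le>\<^sub>M A" if "D \<le>\<^sub>M mp_meet A B"
    using that medvedev_le_trans by blast
  have "mp_meet A B \<le>\<^sub>M B"
    by (rule medvedev_leI_computable[OF computable_prepend[of 1]]) (simp add: mp_meet_def)
  then show "D \<le>\<^sub>M B" if "D \<le>\<^sub>M mp_meet A B"
    using that medvedev_le_trans by blast
next
  assume "D \<le>\<^sub>M A \<and> D \<le>\<^sub>M B"
  then obtain p q where
    p: "\<And>f. f \<in> A \<Longrightarrow> \<exists>g\<in>D. \<forall>x. run f p x (g x)" and
    q: "\<And>f. f \<in> B \<Longrightarrow> \<exists>g\<in>D. \<forall>x. run f q x (g x)"
    using medvedev_leE by metis
  show "D \<le>\<^sub>M mp_meet A B"
  proof (rule medvedev_leI_universal)
    show "computable (\<lambda>f e. if f 0 = 0 then code p else code q)"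
      by (intro computable_intros)
    show "computable (\<lambda>f e. f (Suc e))"
      by (intro computable_intros)
    fix f assume "f \<in> mp_meet A B"
    then consider a where "a \<in> A" "f = prepend 0 a" | b where "b \<in> B" "f = prepend 1 b"
      unfolding mp_meet_def by blast
    then show "\<exists>g\<in>D. \<forall>x. \<exists>r. code r = (if f 0 = 0 then code p else code q) \<and>
        run (\<lambda>e. f (Suc e)) r x (g x)"
    proof cases
      case 1
      obtain g where "g \<in> D" "\<forall>x. run a p x (g x)" using p[OF 1(1)] by blast
      then show ?thesis unfolding 1(2) by auto
    next
      case 2
      obtain g where "g \<in> D" "\<forall>x. run b q x (g x)" using q[OF 2(1)] by blast
      then show ?thesis unfolding 2(2) by auto
    qed
  qed
qed

lemma mp_imp_le_iff: "mp_imp A B \<le>\<^sub>M D \<longleftrightarrow> B \<le>\<^sub>M mp_join A D"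
proof
  have "B \<le>\<^sub>M mp_join A (mp_imp A B)"
  proof (rule medvedev_leI_universal)
    show "computable (\<lambda>f e. f 1)"
      by (intro computable_intros)
    \<comment> \<open>In \<open>a \<oplus> prepend z f\<close> the index \<open>z\<close> stands at
      position 1; skipping it moves the odd half by two.\<close>
    show "computable (\<lambda>f e. if even e then f e else f (Suc (Suc e)))"
      by (intro computable_if decidable_even computable_oracle computable_Suc computable_id)
    fix h assume "h \<in> mp_join A (mp_imp A B)"
    then obtain a z f where a: "a \<in> A" and z: "\<forall>g\<in>A. \<exists>h\<in>B. Phi z (g \<oplus> f) h"
        and h: "h = a \<oplus> prepend z f"
      unfolding mp_join_def mp_imp_def by blast
    have 1: "h 1 = z"
      using interleave_right[of a "prepend z f" 0] h by simp
    have 2: "(\<lambda>e. if even e then h e else h (Suc (Suc e))) = a \<oplus> f"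
      by (auto simp: fun_eq_iff h interleave_def)
    show "\<exists>g\<in>B. \<forall>x. \<exists>p. code p = h 1 \<and>
        run (\<lambda>e. if even e then h e else h (Suc (Suc e))) p x (g x)"
      unfolding 1 2 using bspec[OF z a] unfolding Phi_def by blast
  qed
  moreover assume "mp_imp A B \<le>\<^sub>M D"
  then have "mp_join A (mp_imp A B) \<le>\<^sub>M mp_join A D"
    unfolding mp_join_le_iff using mp_join_upper medvedev_le_trans by blast
  ultimately show "B \<le>\<^sub>M mp_join A D"
    by (rule medvedev_le_trans)
next
  assume "B \<le>\<^sub>M mp_join A D"
  then obtain z where z: "\<forall>f\<in>mp_join A D. \<exists>g\<in>B. Phi z f g"
    unfolding medvedev_le_def by blast
  show "mp_imp A B \<le>\<^sub>M D"
  proof (rule medvedev_leI_computable[OF computable_prepend])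
    show "prepend z f \<in> mp_imp A B" if "f \<in> D" for f
      using z that unfolding mp_imp_def mp_join_def by blast
  qed
qed

lemma mdeg_eq_iff: "mdeg A = mdeg B \<longleftrightarrow> A \<le>\<^sub>M B \<and> B \<le>\<^sub>M A"
  by (simp add: mdegree.abs_eq_iff medvedev_equiv_def)

lemma mrep_mdeg: "mrep (mdeg A) \<le>\<^sub>M A" "A \<le>\<^sub>M mrep (mdeg A)"
  using mdeg_eq_iff Quotient3_abs_rep[OF Quotient3_mdegree] by blast+

lemma medvedev_le_mrep_iff: "mrep (mdeg A) \<le>\<^sub>M D \<longleftrightarrow> A \<le>\<^sub>M D" "D \<le>\<^sub>M mrep (mdeg A) \<longleftrightarrow> D \<le>\<^sub>M A"
  using mrep_mdeg medvedev_le_trans by blast+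

lemma mdeg_join_eqI:
  assumes "\<And>D. C \<le>\<^sub>M D \<longleftrightarrow> A \<le>\<^sub>M D \<and> B \<le>\<^sub>M D"
  shows "mdeg (mp_join (mrep (mdeg A)) (mrep (mdeg B))) = mdeg C"
proof -
  have "mp_join (mrep (mdeg A)) (mrep (mdeg B)) \<le>\<^sub>M D \<longleftrightarrow> C \<le>\<^sub>M D" for D
    by (simp add: assms mp_join_le_iff medvedev_le_mrep_iff)
  then show ?thesis unfolding mdeg_eq_iff using medvedev_le_refl by blast
qed

text \<open>A basic neighbourhood of \<open>y\<close> in the product topology restricts finitely
  many coordinates, all below some \<open>n\<close>.\<close>

lemma mem_closed_if_agree:
  fixes F :: "(nat \<Rightarrow> nat) set"
  assumes "closed F" and *: "\<And>n. \<exists>f\<in>F. agree n y f"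
  shows "y \<in> F"
proof (rule ccontr)
  assume "y \<notin> F"
  have "openin euclidean (- F)"
    using assms(1) by (simp add: open_openin[symmetric] open_Compl)
  then have "openin (product_topology (\<lambda>i. euclidean) UNIV) (- F)"
    by (simp only: euclidean_product_topology)
  from product_topology_open_contains_basis[OF this, of y]
    \<open>y \<notin> F\<close>
  obtain X where X: "y \<in> (\<Pi>\<^sub>E i\<in>UNIV. X i)"
      "finite {i. X i \<noteq> topspace (euclidean :: nat topology)}"
      "(\<Pi>\<^sub>E i\<in>UNIV. X i) \<subseteq> - F"
    by auto
  obtain n where n: "\<forall>i\<in>{i. X i \<noteq> topspace (euclidean :: nat topology)}. i < n"
    using X(2) finite_nat_set_iff_bounded by blast
  obtain f where f: "f \<in> F" "agree n y f"
    using * by blast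
  have "f i \<in> X i" for i
  proof (cases "i < n")
    case True
    then show ?thesis using f(2) PiE_mem[OF X(1), of i] by (simp add: agree_def)
  next
    case False
    then have "X i = UNIV" using n by auto
    then show ?thesis by simp
  qed
  then have "f \<in> (\<Pi>\<^sub>E i\<in>UNIV. X i)" by (simp add: PiE_UNIV_domain)
  then show False using X(3) f(1) by blast
qed

section \<open>Dense mass problems do not help to compute members of closed ones\<close>

definition dense :: "mass_problem \<Rightarrow> bool" where
  "dense X \<longleftrightarrow> (\<forall>f n. \<exists>g\<in>X. agree n f g)"

text \<open>Consistency as a property of the list alone, hence decidable;
  \<open>functional_iff\<close> identifies it with being obeyed by some oracle.\<close>

definition functional :: "nat list \<Rightarrow> bool" where
  "functional cs \<longleftrightarrow> (\<forall>b\<in>set cs. \<forall>c\<in>set cs. fact_prog b = code Oracle \<longrightarrow> fact_prog c = code Oracle \<longrightarrow>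
    fact_arg b = fact_arg c \<longrightarrow> fact_val b = fact_val c)"

lemma functional_iff: "functional cs \<longleftrightarrow> (\<exists>f. obeys f cs)"
proof
  assume cs: "functional cs"
  define P where "P c x \<longleftrightarrow> c \<in> set cs \<and> fact_prog c = code Oracle \<and> fact_arg c = x" for c x
  have "obeys (\<lambda>x. fact_val (SOME c. P c x)) cs"
    unfolding obeys_def
  proof (intro ballI impI)
    fix c assume c: "c \<in> set cs" "fact_prog c = code Oracle"
    then have "P c (fact_arg c)"
      by (simp add: P_def)
    from someI[of "\<lambda>b. P b (fact_arg c)", OF this]
    show "fact_val (SOME b. P b (fact_arg c)) = fact_val c"
      using cs c unfolding functional_def P_def by blast
  qed
  then show "\<exists>f. obeys f cs" by blast
next
  assume "\<exists>f. obeys f cs"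
  then obtain f where obeys: "obeys f cs" by blast
  have f: "fact_val c = f (fact_arg c)" if "c \<in> set cs" "fact_prog c = code Oracle" for c
    using obeys that unfolding obeys_def by simp
  show "functional cs"
    unfolding functional_def
  proof (intro ballI impI)
    fix b c
    assume "b \<in> set cs" "c \<in> set cs" "fact_prog b = code Oracle" "fact_prog c = code Oracle"
      and arg: "fact_arg b = fact_arg c"
    then have "fact_val b = f (fact_arg b)" "fact_val c = f (fact_arg c)"
      using f by blast+
    then show "fact_val b = fact_val c" using arg by simp
  qed
qed

lemma decidable_functional:
  assumes D: "computable D"
  shows "decidable (\<lambda>f e. functional (facts (D f e)))"
  unfolding functional_def
  by (intro decidable_ball_facts computable_intros computable_comp[OF D] D)

text \<open>Meant for oracles \<open>g \<oplus> h\<close> with \<open>g\<close> unknown: claims at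
  odd arguments are checked against \<open>h\<close>, those at even arguments only against each
  other.\<close>

definition compatible :: "(nat \<Rightarrow> nat) \<Rightarrow> nat list \<Rightarrow> bool" where
  "compatible h cs \<longleftrightarrow> functional cs \<and> (\<forall>c\<in>set cs. fact_prog c = code Oracle \<longrightarrow>
    odd (fact_arg c) \<longrightarrow> h (fact_arg c div 2) = fact_val c)"

lemma decidable_compatible:
  assumes D: "computable D"
  shows "decidable (\<lambda>f e. compatible f (facts (D f e)))"
  unfolding compatible_def
  by (intro decidable_functional decidable_ball_facts computable_intros decidable_even
      computable_half computable_comp[OF D] D)

text \<open>The claims at even arguments are a finite condition on \<open>g\<close>, which a dense
  set meets as soon as it is consistent. So the search for a realisation in \<open>X\<close> becomes
  decidable from \<open>h\<close>.\<close>

lemma compatible_iff: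
  assumes "dense X"
  shows "compatible h cs \<longleftrightarrow> (\<exists>g\<in>X. obeys (g \<oplus> h) cs)"
proof
  assume *: "compatible h cs"
  then obtain f where "obeys f cs"
    by (auto simp: compatible_def functional_iff)
  then have "obeys ((\<lambda>x. f (2 * x)) \<oplus> h) cs"
    using * by (auto simp: obeys_def compatible_def interleave_def)
  moreover obtain n where n: "\<And>f f'. obeys f cs \<Longrightarrow> agree n f f' \<Longrightarrow> obeys f' cs"
    using finite_obeys_agree by blast
  moreover obtain g where "g \<in> X" "agree n (\<lambda>x. f (2 * x)) g"
    using assms unfolding dense_def by blast
  moreover from this have "agree n ((\<lambda>x. f (2 * x)) \<oplus> h) (g \<oplus> h)"
    by (auto simp: agree_def interleave_def)
  ultimately show "\<exists>g\<in>X. obeys (g \<oplus> h) cs" by blast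
next
  assume "\<exists>g\<in>X. obeys (g \<oplus> h) cs"
  then obtain g where "obeys (g \<oplus> h) cs" by blast
  then show "compatible h cs"
    unfolding compatible_def functional_iff by (auto simp: obeys_def interleave_def)
qed

text \<open>
  Given \<open>h \<in> C\<close>, grow a derivation that answers \<open>0, 1, 2, \<dots>\<close> and keep what it assumes about the
  oracle from \<open>X\<close> consistent. By density every stage is realised by some member of \<open>X\<close>, so every
  initial segment of the result extends to a member of \<open>F\<close>.
\<close>

theorem medvedev_le_if_dense:
  assumes F: "closed F" and X: "dense X" and le: "F \<le>\<^sub>M mp_join X C"
  shows "F \<le>\<^sub>M C"
proof -
  obtain p where "\<And>f. f \<in> mp_join X C \<Longrightarrow> \<exists>y\<in>F. \<forall>x. run f p x (y x)"
    using le medvedev_leE by blast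
  then have p: "\<exists>y\<in>F. \<forall>x. run (g \<oplus> h) p x (y x)" if "g \<in> X" "h \<in> C" for g h
    using that unfolding mp_join_def by blast
  \<comment> \<open>\<open>e\<close> has the shape \<open>pair 0 (pair n a)\<close> in which
    \<open>PrimRec\<close> calls its step program, \<open>a\<close> being the previous stage. A
    stage packs a derivation with the newest answer.\<close>
  define Q where "Q = (\<lambda>h e s. derivation (facts (pr1 s)) \<and> compatible h (facts (pr1 s)) \<and>
    (\<forall>c\<in>set (facts (pr1 (pr2 (pr2 e)))). c \<in> set (facts (pr1 s))) \<and>
    fact_of (code p) (pr1 (pr2 e)) (pr2 s) \<in> set (facts (pr1 s)))"
  have "decidable (\<lambda>h e. Q h (pr1 e) (pr2 e))"
    unfolding Q_def
    by (intro computable_intros decidable_mem_facts decidable_derivation decidable_compatible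
        decidable_ball_facts)
  from search_program[OF this] obtain q where
    q: "\<And>h e. \<exists>s. Q h e s \<Longrightarrow> \<exists>s. Q h e s \<and> run h q e s" by metis
  let ?r = "PrimRec Zero q"
  \<comment> \<open>The answer at \<open>x\<close> is produced by stage
    \<open>Suc x\<close>.\<close>
  obtain c where c: "\<And>f x. run f c x (pair 0 (Suc x))"
    using computable_pair[OF computable_const computable_Suc[OF computable_id]]
    unfolding computable_def by blast
  have "\<exists>y\<in>F. \<forall>x. run h (Comp Snd (Comp ?r c)) x (y x)" if h: "h \<in> C" for h
  proof -
    define I where "I n s \<longleftrightarrow> run h ?r (pair 0 n) s \<and> derivation (facts (pr1 s)) \<and>
      compatible h (facts (pr1 s))" for n s
    have "\<exists>s. \<forall>n. I n (s n) \<and> Q h (pair 0 (pair n (s n))) (s (Suc n))"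
    proof (rule dependent_nat_choice)
      \<comment> \<open>\<open>PrimRec Zero q\<close> starts from the number 0, which has to decode
        to the empty derivation.\<close>
      have "facts (pr1 0) = []"
        by (simp add: facts_def prod_decode_def prod_decode_aux.simps)
      then show "\<exists>s. I 0 s"
        unfolding I_def
        by (intro exI[of _ 0]) (auto simp: derivation_Nil compatible_def functional_def intro: run_PrimRec_0 run_Zero)
    next
      fix s n assume s: "I n s"
      \<comment> \<open>\<open>g\<close> only shows that a next stage exists; the stage picked by
        the search may need another member of \<open>X\<close> to realise it.\<close>
      then obtain g where g: "g \<in> X" "obeys (g \<oplus> h) (facts (pr1 s))"
        using compatible_iff[OF X] by (auto simp: I_def)
      then obtain y where "run (g \<oplus> h) p n y"
        using p h by blast
      then obtain cs where cs: "derivation cs" "obeys (g \<oplus> h) cs" "fact_of (code p) n y \<in> set cs"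
        unfolding run_iff_derivation by blast
      obtain D where D: "facts D = facts (pr1 s) @ cs"
        using ex_facts by blast
      have "derivation (facts D)"
        using s cs by (auto simp: D I_def intro: derivation_append)
      moreover have "compatible h (facts D)"
        using g cs by (auto simp: compatible_iff[OF X] D obeys_append)
      ultimately have "Q h (pair 0 (pair n s)) (pair D y)"
        using cs by (simp add: Q_def D)
      then obtain s' where s': "Q h (pair 0 (pair n s)) s'" "run h q (pair 0 (pair n s)) s'"
        using q by blast
      have "run h ?r (pair 0 (Suc n)) s'"
        using s s'(2) by (auto simp: I_def intro: run_PrimRec_Suc)
      then show "\<exists>s'. I (Suc n) s' \<and> Q h (pair 0 (pair n s)) s'"
        using s'(1) unfolding I_def by (auto simp: Q_def)
    qed
    then obtain s where s: "\<And>n. I n (s n)" "\<And>n. Q h (pair 0 (pair n (s n))) (s (Suc n))"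
      by blast
    define y where "y n = pr2 (s (Suc n))" for n
    have mono: "set (facts (pr1 (s m))) \<subseteq> set (facts (pr1 (s n)))" if "m \<le> n" for m n
      by (rule lift_Suc_mono_le[OF _ that, of "\<lambda>n. set (facts (pr1 (s n)))"])
        (use s(2) in \<open>auto simp: Q_def\<close>)
    have "y \<in> F"
    proof (rule mem_closed_if_agree[OF F])
      fix n
      have n: "derivation (facts (pr1 (s n)))" "compatible h (facts (pr1 (s n)))"
        using s(1)[of n] by (auto simp: I_def)
      then obtain g where g: "g \<in> X" "obeys (g \<oplus> h) (facts (pr1 (s n)))"
        using compatible_iff[OF X] by blast
      then obtain y' where y': "y' \<in> F" "\<And>x. run (g \<oplus> h) p x (y' x)"
        using p h by blast
      have "y k = y' k" if "k < n" for k
      proof -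
        have "fact_of (code p) k (y k) \<in> set (facts (pr1 (s (Suc k))))"
          using s(2)[of k] by (simp add: Q_def y_def)
        then have "fact_of (code p) k (y k) \<in> set (facts (pr1 (s n)))"
          using mono[of "Suc k" n] that by auto
        then have "run (g \<oplus> h) p k (y k)"
          using run_if_derivation n(1) g(2) by blast
        then show ?thesis using y'(2) run_functional by blast
      qed
      then show "\<exists>f\<in>F. agree n y f"
        using y'(1) by (auto simp: agree_def)
    qed
    moreover have "run h (Comp Snd (Comp ?r c)) x (y x)" for x
    proof (rule run_Comp)
      show "run h (Comp ?r c) x (s (Suc x))"
        using s(1)[of "Suc x"] c by (auto simp: I_def intro: run_Comp)
      show "run h Snd (s (Suc x)) (y x)"
        unfolding y_def by (rule run_Snd)
    qed
    ultimately show ?thesis by blast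
  qed
  then show ?thesis by (rule medvedev_leI)
qed

section \<open>Turing reducibility and forcing by initial segments\<close>

definition turing_le :: "(nat \<Rightarrow> nat) \<Rightarrow> (nat \<Rightarrow> nat) \<Rightarrow> bool" (infix "\<le>\<^sub>T" 50) where
  "f \<le>\<^sub>T g \<longleftrightarrow> (\<exists>p. \<forall>x. run g p x (f x))"

text \<open>Being computable is expressed as being reducible to this oracle.\<close>

abbreviation null :: "nat \<Rightarrow> nat" where
  "null \<equiv> \<lambda>_. 0"

lemma run_computable:
  assumes "computable F"
  obtains q where "\<And>f x y. run (F f) p x y \<Longrightarrow> run f q x y"
  using assms run_subst_oracle unfolding computable_def by metis

lemma computable_transform:
  assumes "computable S" and "computable T"
  shows "computable (\<lambda>f. S (T f))"
proof -
  obtain p q where "\<And>f x. run f p x (S f x)" and "\<And>f x. run f q x (T f x)"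
    using assms unfolding computable_def by blast
  then have "\<And>f x. run f (subst_oracle q p) x (S (T f) x)"
    using run_subst_oracle by blast
  then show ?thesis by (rule computableI)
qed

lemma turing_le_refl: "f \<le>\<^sub>T f"
  unfolding turing_le_def using run_Oracle by blast

lemma turing_le_trans: "f \<le>\<^sub>T g \<Longrightarrow> g \<le>\<^sub>T h \<Longrightarrow> f \<le>\<^sub>T h"
  unfolding turing_le_def using run_subst_oracle by meson

lemma turing_le_computable: "computable F \<Longrightarrow> F f \<le>\<^sub>T f"
  unfolding turing_le_def computable_def by blast

lemma null_turing_le: "null \<le>\<^sub>T f"
  unfolding turing_le_def using run_Zero by blast

lemma medvedev_le_singleton: "F \<le>\<^sub>M {h} \<longleftrightarrow> (\<exists>y\<in>F. y \<le>\<^sub>T h)"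
  unfolding medvedev_le_iff_prog turing_le_def by blast

definition patch :: "nat \<Rightarrow> (nat \<Rightarrow> nat) \<Rightarrow> (nat \<Rightarrow> nat) \<Rightarrow> nat \<Rightarrow> nat" where
  "patch m g f = (\<lambda>k. if k < m then g k else f k)"

lemma computable_patch: "computable (patch m g)"
proof -
  have "computable (\<lambda>f e. if e < m then (if e < m then g e else 0) else f e)"
    by (intro computable_if computable_finite_table computable_intros)
  moreover have "(\<lambda>f e. if e < m then (if e < m then g e else 0) else f e) = patch m g"
    by (auto simp: patch_def fun_eq_iff)
  ultimately show ?thesis by simp
qed

text \<open>Otherwise the functions \<open>K\<close> from which \<open>p\<close> computes a member of \<open>F\<close> would be dense.\<close>

lemma ex_agree_not_computing:
  assumes F: "closed F" "\<And>y. y \<in> F \<Longrightarrow> \<not> y \<le>\<^sub>T null" and T: "computable T"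
  shows "\<exists>H n. agree m G H \<and> (\<forall>H'. agree n H H' \<longrightarrow> \<not> (\<exists>y\<in>F. \<forall>x. run (T H') p x (y x)))"
proof (rule ccontr)
  assume "\<not> ?thesis"
  then have *: "\<exists>H'. agree n H H' \<and> (\<exists>y\<in>F. \<forall>x. run (T H') p x (y x))" if "agree m G H" for H n
    using that by blast
  define X where "X = {K. \<exists>y\<in>F. \<forall>x. run (T (patch m G K)) p x (y x)}"
  have "dense X"
    unfolding dense_def
  proof (intro allI)
    fix K n
    have "agree m G (patch m G K)" by (simp add: agree_def patch_def)
    from *[OF this] obtain H' where H': "agree (max m n) (patch m G K) H'"
        "\<exists>y\<in>F. \<forall>x. run (T H') p x (y x)" by blast
    \<comment> \<open>\<open>H'\<close> starts with \<open>m\<close> values of \<open>G\<close> and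
      continues with those of \<open>K\<close> up to \<open>n\<close>, so overwriting these segments
      restores it.\<close>
    have "patch m G (patch n K H') = H'"
      using H'(1) by (auto simp: fun_eq_iff patch_def agree_def split: if_splits)
    then have "patch n K H' \<in> X" using H'(2) by (simp add: X_def)
    moreover have "agree n K (patch n K H')" by (simp add: agree_def patch_def)
    ultimately show "\<exists>g\<in>X. agree n K g" by blast
  qed
  moreover have "F \<le>\<^sub>M X"
  proof -
    obtain q where "\<And>K x y. run (T (patch m G K)) p x y \<Longrightarrow> run K q x y"
      using run_computable[OF computable_transform[OF T computable_patch]] by blast
    then have "\<exists>y\<in>F. \<forall>x. run K q x (y x)" if "K \<in> X" for K
      using that unfolding X_def by blast
    then show ?thesis by (rule medvedev_leI)
  qed
  \<comment> \<open>A computable second component puts the reduction into the form from which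
    density removes \<open>X\<close>; what remains is a computable member of
    \<open>F\<close>.\<close>
  then have "F \<le>\<^sub>M mp_join X {null}"
    using mp_join_upper medvedev_le_trans by blast
  ultimately have "F \<le>\<^sub>M {null}"
    using medvedev_le_if_dense F(1) by blast
  then show False using F(2) by (auto simp: medvedev_le_singleton)
qed

section \<open>Generic functions\<close>

text \<open>
  \<open>G\<close> decides \<open>Q\<close> if \<open>G\<close> lies in the interior of \<open>Q\<close> or in the interior of the complement of that.
\<close>

definition decides :: "(nat \<Rightarrow> nat) \<Rightarrow> ((nat \<Rightarrow> nat) \<Rightarrow> bool) \<Rightarrow> bool" where
  "decides G Q \<longleftrightarrow> (\<exists>m. (\<forall>H. agree m G H \<longrightarrow> Q H) \<or>
    (\<forall>H. agree m G H \<longrightarrow> \<not> (\<exists>n. \<forall>H'. agree n H H' \<longrightarrow> Q H')))"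

lemma agree_refl: "agree n f f"
  by (simp add: agree_def)

lemma agree_trans: "agree m f g \<Longrightarrow> agree n g h \<Longrightarrow> m \<le> n \<Longrightarrow> agree m f h"
  by (auto simp: agree_def)

text \<open>Finite extension: stage \<open>n\<close> moves into the interior of \<open>Q n\<close>
  if the current condition permits this. Otherwise no extension of the condition reaches that
  interior, which is the other way to decide \<open>Q n\<close>.\<close>

lemma ex_generic:
  assumes "countable \<Q>"
  shows "\<exists>G. \<forall>Q\<in>\<Q>. decides G Q"
proof (cases "\<Q> = {}")
  case False
  define Q where "Q n = from_nat_into \<Q> n" for n
  have range: "\<Q> = range Q"
    unfolding Q_def using range_from_nat_into[OF False assms] by simp
  \<comment> \<open>\<open>(G, m)\<close> stands for the first \<open>m\<close> values of
    \<open>G\<close>; \<open>m < m'\<close> makes the conditions converge to a total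
    function.\<close>
  define P where "P = (\<lambda>n (G, m) (G', m'). m < m' \<and> agree m G G' \<and>
    ((\<forall>H. agree m' G' H \<longrightarrow> Q n H) \<or>
     (\<forall>H. agree m G H \<longrightarrow> \<not> (\<exists>k. \<forall>H'. agree k H H' \<longrightarrow> Q n H'))))"
  have "\<exists>s :: nat \<Rightarrow> (nat \<Rightarrow> nat) \<times> nat. \<forall>n. True \<and> P n (s n) (s (Suc n))"
  proof (rule dependent_nat_choice)
    fix s :: "(nat \<Rightarrow> nat) \<times> nat" and n
    obtain G m where s: "s = (G, m)" by (cases s)
    show "\<exists>s'. True \<and> P n s s'"
    proof (cases "\<exists>H k. agree m G H \<and> (\<forall>H'. agree k H H' \<longrightarrow> Q n H')")
      case True
      then obtain H k where "agree m G H" "\<forall>H'. agree k H H' \<longrightarrow> Q n H'" by blast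
      then have "P n s (H, max k (Suc m))"
        by (auto simp: P_def s agree_def)
      then show ?thesis by blast
    next
      case False
      then have "P n s (G, Suc m)"
        by (auto simp: P_def s agree_refl)
      then show ?thesis by blast
    qed
  qed auto
  then obtain s where s: "\<And>n. P n (s n) (s (Suc n))" by blast
  define g m where "g n = fst (s n)" and "m n = snd (s n)" for n
  have step: "m n < m (Suc n)" "agree (m n) (g n) (g (Suc n))"
    "(\<forall>H. agree (m (Suc n)) (g (Suc n)) H \<longrightarrow> Q n H) \<or>
     (\<forall>H. agree (m n) (g n) H \<longrightarrow> \<not> (\<exists>k. \<forall>H'. agree k H H' \<longrightarrow> Q n H'))" for n
    using s[of n] by (auto simp: P_def g_def m_def split: prod.splits)
  have mono: "m i \<le> m j" if "i \<le> j" for i j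
    by (rule lift_Suc_mono_le[OF _ that]) (use step(1) in \<open>auto intro: less_imp_le\<close>)
  have "strict_mono m"
    using step(1) by (simp add: strict_mono_Suc_iff)
  then have le: "n \<le> m n" for n
    by (rule strict_mono_imp_increasing)
  have stable: "agree (m i) (g i) (g j)" if "i \<le> j" for i j
    using that
  proof (induction j rule: dec_induct)
    case (step j)
    then show ?case using agree_trans step.IH \<open>\<And>n. agree (m n) (g n) (g (Suc n))\<close> mono by blast
  qed (rule agree_refl)
  \<comment> \<open>The value at \<open>k\<close> is settled at stage \<open>Suc k\<close>, because
    \<open>k < m (Suc k)\<close>.\<close>
  define G where "G k = g (Suc k) k" for k
  have G: "agree (m n) (g n) G" for n
    unfolding agree_def
  proof (intro allI impI)
    fix k assume k: "k < m n"
    have "k < m (Suc k)" using le[of "Suc k"] by simp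
    then show "g n k = G k"
      using k stable[of n "Suc k"] stable[of "Suc k" n]
      unfolding G_def agree_def by (metis nat_le_linear)
  qed
  have "decides G (Q n)" for n
  proof -
    have "agree (m i) (g i) H" if "agree (m i) G H" for i H
      using agree_trans[OF G that order_refl] .
    then have "(\<forall>H. agree (m (Suc n)) G H \<longrightarrow> Q n H) \<or>
        (\<forall>H. agree (m n) G H \<longrightarrow> \<not> (\<exists>k. \<forall>H'. agree k H H' \<longrightarrow> Q n H'))"
      using step(3)[of n] by blast
    then show ?thesis unfolding decides_def by blast
  qed
  then show ?thesis using range by auto
qed auto

definition computes_member :: "mass_problem \<Rightarrow> prog \<Rightarrow> (nat \<Rightarrow> nat) \<Rightarrow> bool" where
  "computes_member F p f \<longleftrightarrow> (\<exists>y\<in>F. \<forall>x. run f p x (y x))"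

lemma ex_computes_member_iff: "(\<exists>p. computes_member F p f) \<longleftrightarrow> (\<exists>y\<in>F. y \<le>\<^sub>T f)"
  by (auto simp: computes_member_def turing_le_def)

text \<open>By \<open>ex_agree_not_computing\<close> every condition extends to one that forces the
  failure, so the second alternative of \<open>decides\<close> is excluded and the first applies to
  \<open>G\<close> itself.\<close>

lemma decides_not_computes_member:
  assumes "closed F" and "\<And>y. y \<in> F \<Longrightarrow> \<not> y \<le>\<^sub>T null" and "computable T"
    and "decides G (\<lambda>H. \<not> computes_member F p (T H))"
  shows "\<not> computes_member F p (T G)"
  using assms(4) ex_agree_not_computing[OF assms(1-3), of _ G p] agree_refl
  unfolding decides_def computes_member_def by blast

definition column :: "nat \<Rightarrow> (nat \<Rightarrow> nat) \<Rightarrow> nat \<Rightarrow> nat" where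
  "column i f = (\<lambda>x. f (pair i x))"

lemma computable_column: "computable (column i)"
  unfolding column_def by (intro computable_intros)

text \<open>Otherwise some condition on \<open>G\<close> would leave the reduction always
  recoverable. Change \<open>G\<close> at one place of column \<open>i\<close> beyond that
  condition: column \<open>j\<close> stays the same up to the use, so the old and now wrong value is
  still computed.\<close>

lemma decides_not_computes_column:
  assumes "i \<noteq> j"
    and "decides G (\<lambda>H. \<not> (\<forall>x. run (column j H) p x (column i H x)))"
  shows "\<not> (\<forall>x. run (column j G) p x (column i G x))"
proof
  assume G: "\<forall>x. run (column j G) p x (column i G x)"
  then obtain m where m: "\<And>H n. agree m G H \<Longrightarrow>
      \<exists>H'. agree n H H' \<and> (\<forall>x. run (column j H') p x (column i H' x))"
    using assms(2) agree_refl unfolding decides_def by blast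
  obtain n where n: "\<And>h. agree n (column j G) h \<Longrightarrow> run h p m (column i G m)"
    using run_use G by blast
  \<comment> \<open>Asking for argument \<open>m\<close>, the length of the condition, puts the
    change at \<open>pair i m \<ge> m\<close>, outside the condition.\<close>
  define k where "k = pair i m"
  define l where "l = Max (insert k (pair j ` {..<n}))"
  have "m \<le> k" unfolding k_def by (rule le_prod_encode_2)
  then have "agree m G (G(k := Suc (G k)))"
    by (simp add: agree_def)
  from m[OF this, of "Suc l"] obtain H where
    H: "agree (Suc l) (G(k := Suc (G k))) H" "\<forall>x. run (column j H) p x (column i H x)"
    by blast
  have less: "k < Suc l" "\<And>x. x < n \<Longrightarrow> pair j x < Suc l"
    unfolding l_def less_Suc_eq_le by (intro Max_ge; simp)+
  have "G (pair j x) = H (pair j x)" if "x < n" for x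
    using H(1)[unfolded agree_def, rule_format, OF less(2)[OF that]] assms(1) by (simp add: k_def)
  then have "agree n (column j G) (column j H)"
    by (simp add: agree_def column_def)
  then have "run (column j H) p m (column i G m)"
    by (rule n)
  then have "column i H m = column i G m"
    using H(2) run_functional by blast
  moreover have "H k = Suc (G k)"
    using H(1) less(1) by (auto simp: agree_def)
  ultimately show False
    by (simp add: column_def k_def)
qed

lemma countable_prog: "countable (UNIV :: prog set)"
  by (rule countableI[of code]) (simp add: inj_on_def code_inject)

text \<open>The columns of a single generic function; there are only countably many
  requirements.\<close>

theorem ex_turing_antichain:
  assumes F: "closed F" "\<And>y. y \<in> F \<Longrightarrow> \<not> y \<le>\<^sub>T null"
  obtains f :: "nat \<Rightarrow> nat \<Rightarrow> nat" where
    "\<And>i y. y \<in> F \<Longrightarrow> \<not> y \<le>\<^sub>T f i" and "\<And>i j. i \<noteq> j \<Longrightarrow> \<not> f i \<le>\<^sub>T f j"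
proof -
  let ?N = "\<lambda>(i, p) H. \<not> computes_member F p (column i H)"
  let ?C = "\<lambda>(i, j, p) H. \<not> (\<forall>x. run (column j H) p x (column i H x))"
  have "countable (?N ` (UNIV \<times> UNIV) \<union> ?C ` (UNIV \<times> UNIV \<times> UNIV))"
    by (intro countable_Un countable_image countable_SIGMA countable_prog countableI_type)
  then obtain G where *: "\<forall>Q\<in>?N ` (UNIV \<times> UNIV) \<union> ?C ` (UNIV \<times> UNIV \<times> UNIV). decides G Q"
    using ex_generic by blast
  have G: "decides G (?N (i, p))" "decides G (?C (i, j, p))" for i j p
    using * by blast+
  note G = G[unfolded prod.case]
  show ?thesis
  proof
    show "\<not> y \<le>\<^sub>T column i G" if "y \<in> F" for i y
      using decides_not_computes_member[OF F computable_column G(1)] that ex_computes_member_iff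
      by blast
    show "\<not> column i G \<le>\<^sub>T column j G" if "i \<noteq> j" for i j
      using decides_not_computes_column[OF that G(2)] unfolding turing_le_def by blast
  qed
qed

section \<open>Two generic functions that jointly compute a given one\<close>

text \<open>Swaps each even value with its successor at the places in \<open>S\<close>. The swap is
  an involution without fixed values and respects initial segments, so forcing arguments transfer
  along it and \<open>S\<close> is recovered by comparison.\<close>

definition flip_at :: "nat set \<Rightarrow> (nat \<Rightarrow> nat) \<Rightarrow> nat \<Rightarrow> nat" where
  "flip_at S g k = (if k \<in> S then (if even (g k) then Suc (g k) else g k - 1) else g k)"

lemma flip_at_flip_at: "flip_at S (flip_at S g) = g"
  by (auto simp: flip_at_def fun_eq_iff)

lemma flip_at_eq_iff: "flip_at S g k = g k \<longleftrightarrow> k \<notin> S"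
  by (auto simp: flip_at_def elim: oddE)

lemma agree_flip_at: "agree n f g \<Longrightarrow> agree n (flip_at S f) (flip_at S g)"
  by (simp add: agree_def flip_at_def)

theorem ex_turing_split:
  assumes F: "closed F" "\<And>y. y \<in> F \<Longrightarrow> \<not> y \<le>\<^sub>T null"
  obtains b c where
    "\<And>y. y \<in> F \<Longrightarrow> \<not> y \<le>\<^sub>T b" and "\<And>y. y \<in> F \<Longrightarrow> \<not> y \<le>\<^sub>T c" and "f \<le>\<^sub>T b \<oplus> c"
proof -
  define S where "S = {k. f (pr1 k) = pr2 k}"
  have id: "computable (\<lambda>f. f)"
    by (intro computable_intros)
  have "countable (range (\<lambda>p H. \<not> computes_member F p H) \<union>
      range (\<lambda>p H. \<not> computes_member F p (flip_at S H)))"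
    by (intro countable_Un countable_image countable_prog)
  then obtain G where *: "\<forall>Q\<in>range (\<lambda>p H. \<not> computes_member F p H) \<union>
      range (\<lambda>p H. \<not> computes_member F p (flip_at S H)). decides G Q"
    using ex_generic by blast
  have G: "decides G (\<lambda>H. \<not> computes_member F p H)"
      "decides G (\<lambda>H. \<not> computes_member F p (flip_at S H))" for p
    using * by blast+
  show ?thesis
  proof
    show "\<not> y \<le>\<^sub>T G" if "y \<in> F" for y
      using decides_not_computes_member[OF F id G(1)] that ex_computes_member_iff by blast
    have "\<not> computes_member F p (flip_at S G)" for p
    proof -
      \<comment> \<open>\<open>S\<close> may be noncomputable, so \<open>flip_at S\<close> cannot
        play the role of \<open>T\<close>. The condition is found on the flipped side with the
        identity and carried back by the involution.\<close>
      have "\<exists>H n. agree m G H \<and> (\<forall>H'. agree n H H' \<longrightarrow> \<not> computes_member F p (flip_at S H'))" for m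
      proof -
        obtain H n where H: "agree m (flip_at S G) H"
            "\<forall>H'. agree n H H' \<longrightarrow> \<not> computes_member F p H'"
          using ex_agree_not_computing[OF F id, of m "flip_at S G" p]
          unfolding computes_member_def by blast
        show ?thesis
        proof (intro exI conjI allI impI)
          show "agree m G (flip_at S H)"
            using agree_flip_at[OF H(1), of S] by (simp add: flip_at_flip_at)
          show "\<not> computes_member F p (flip_at S H')" if "agree n (flip_at S H) H'" for H'
            using agree_flip_at[OF that, of S] H(2) by (simp add: flip_at_flip_at)
        qed
      qed
      then show ?thesis
        using G(2)[of p] agree_refl unfolding decides_def by blast
    qed
    then show "\<not> y \<le>\<^sub>T flip_at S G" if "y \<in> F" for y
      using that ex_computes_member_iff by blast
    let ?h = "G \<oplus> flip_at S G"
    \<comment> \<open>The two halves differ at \<open>pair x n\<close> exactly when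
      \<open>n = f x\<close>, so a search recovers \<open>f\<close>.\<close>
    define Q where "Q h x n \<longleftrightarrow> h (2 * pair x n) \<noteq> h (Suc (2 * pair x n))"
      for h :: "nat \<Rightarrow> nat" and x n
    have "decidable (\<lambda>h e. Q h (pr1 e) (pr2 e))"
      unfolding Q_def by (intro computable_intros computable_double)
    from search_program[OF this] obtain p where
      p: "\<And>h x. \<exists>n. Q h x n \<Longrightarrow> \<exists>n. Q h x n \<and> run h p x n" by metis
    have "Q ?h x n \<longleftrightarrow> f x = n" for x n
      using flip_at_eq_iff[of S G "pair x n"] unfolding Q_def interleave_left interleave_right
      by (auto simp: S_def)
    then have "run ?h p x (f x)" for x
      using p by metis
    then show "f \<le>\<^sub>T ?h"
      unfolding turing_le_def by blast
  qed
qed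

section \<open>The distributive lattice of Medvedev degrees\<close>

instantiation mdegree :: "{distrib_lattice, bounded_lattice_bot}"
begin

definition less_eq_mdegree :: "mdegree \<Rightarrow> mdegree \<Rightarrow> bool" where
  "a \<le> b \<longleftrightarrow> mdeg_le a b"

definition less_mdegree :: "mdegree \<Rightarrow> mdegree \<Rightarrow> bool" where
  "a < b \<longleftrightarrow> a \<le> b \<and> \<not> b \<le> (a :: mdegree)"

definition sup_mdegree :: "mdegree \<Rightarrow> mdegree \<Rightarrow> mdegree" where
  "sup a b = mdeg (mp_join (mrep a) (mrep b))"

definition inf_mdegree :: "mdegree \<Rightarrow> mdegree \<Rightarrow> mdegree" where
  "inf a b = mdeg (mp_meet (mrep a) (mrep b))"

definition bot_mdegree :: mdegree where
  "bot = mdeg UNIV"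

lemma mdeg_le_mdeg_iff: "mdeg A \<le> mdeg B \<longleftrightarrow> A \<le>\<^sub>M B"
  by (simp add: less_eq_mdegree_def mdeg_le.abs_eq)

lemma mdeg_mrep: "mdeg (mrep a) = a"
  by (rule Quotient3_abs_rep[OF Quotient3_mdegree])

lemma sup_mdeg_le_iff: "sup a b \<le> c \<longleftrightarrow> a \<le> c \<and> b \<le> (c :: mdegree)"
  unfolding sup_mdegree_def
  by (metis mdeg_le_mdeg_iff mdeg_mrep mp_join_le_iff)

lemma le_inf_mdeg_iff: "c \<le> inf a b \<longleftrightarrow> c \<le> a \<and> c \<le> (b :: mdegree)"
  unfolding inf_mdegree_def
  by (metis mdeg_le_mdeg_iff mdeg_mrep le_mp_meet_iff)

text \<open>Introduced before the instance proof because distributivity is derived from it.\<close>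

definition impl_mdegree :: "mdegree \<Rightarrow> mdegree \<Rightarrow> mdegree" where
  "impl_mdegree a b = mdeg (mp_imp (mrep a) (mrep b))"

lemma impl_mdegree_le_iff: "impl_mdegree a b \<le> c \<longleftrightarrow> b \<le> sup a c"
proof -
  have "impl_mdegree a b \<le> c \<longleftrightarrow> mrep b \<le>\<^sub>M mp_join (mrep a) (mrep c)"
    unfolding impl_mdegree_def by (metis mdeg_le_mdeg_iff mdeg_mrep mp_imp_le_iff)
  then show ?thesis
    unfolding sup_mdegree_def by (metis mdeg_le_mdeg_iff mdeg_mrep)
qed

instance
proof
  fix a b c :: mdegree
  show "a < b \<longleftrightarrow> a \<le> b \<and> \<not> b \<le> a"
    by (rule less_mdegree_def)
  show refl: "a \<le> a" for a :: mdegree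
    by (metis mdeg_le_mdeg_iff mdeg_mrep medvedev_le_refl)
  show trans: "a \<le> b \<Longrightarrow> b \<le> c \<Longrightarrow> a \<le> c" for a b c :: mdegree
    by (metis mdeg_le_mdeg_iff mdeg_mrep medvedev_le_trans)
  show antisym: "a \<le> b \<Longrightarrow> b \<le> a \<Longrightarrow> a = b" for a b :: mdegree
    by (metis mdeg_le_mdeg_iff mdeg_mrep mdeg_eq_iff)
  show "inf a b \<le> a" "inf a b \<le> b" "a \<le> b \<Longrightarrow> a \<le> c \<Longrightarrow> a \<le> inf b c"
    using le_inf_mdeg_iff refl by blast+
  show upper: "a \<le> sup a b" "b \<le> sup a b" for a b :: mdegree
    using sup_mdeg_le_iff refl by blast+
  show "b \<le> a \<Longrightarrow> c \<le> a \<Longrightarrow> sup b c \<le> a"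
    using sup_mdeg_le_iff by blast
  show "bot \<le> a"
    unfolding bot_mdegree_def
    by (metis mdeg_le_mdeg_iff mdeg_mrep medvedev_le_subset subset_UNIV)
  show "sup a (inf b c) = inf (sup a b) (sup a c)"
  proof (rule antisym)
    have inf: "inf x y \<le> x" "inf x y \<le> y" for x y :: mdegree
      using le_inf_mdeg_iff refl by blast+
    show "sup a (inf b c) \<le> inf (sup a b) (sup a c)"
      unfolding le_inf_mdeg_iff sup_mdeg_le_iff
      using upper trans[OF inf(1) upper(2)] trans[OF inf(2) upper(2)] by blast
    \<comment> \<open>\<open>sup a\<close> is the right adjoint of \<open>impl_mdegree a\<close> and
      hence preserves meets.\<close>
    have "impl_mdegree a (inf (sup a b) (sup a c)) \<le> inf b c"
      unfolding le_inf_mdeg_iff impl_mdegree_le_iff using inf by blast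
    then show "inf (sup a b) (sup a c) \<le> sup a (inf b c)"
      by (simp only: impl_mdegree_le_iff)
  qed
qed

end

lemma sup_mdeg: "sup (mdeg A) (mdeg B) = mdeg (mp_join A B)"
  unfolding sup_mdegree_def by (rule mdeg_join_eqI) (rule mp_join_le_iff)

lemma impl_mdegree_eqI: "(\<And>d. c \<le> d \<longleftrightarrow> b \<le> sup a d) \<Longrightarrow> impl_mdegree a b = c"
  using impl_mdegree_le_iff by (metis order_antisym order_refl)

lemma mdeg_eq_bot_iff: "mdeg A = bot \<longleftrightarrow> (\<exists>y\<in>A. y \<le>\<^sub>T null)"
proof -
  have "mdeg A = bot \<longleftrightarrow> A \<le>\<^sub>M UNIV"
    using mdeg_le_mdeg_iff[of A UNIV] bot_unique[of "mdeg A"] by (simp add: bot_mdegree_def)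
  also have "\<dots> \<longleftrightarrow> A \<le>\<^sub>M {null}"
  proof
    show "A \<le>\<^sub>M UNIV \<Longrightarrow> A \<le>\<^sub>M {null}"
      using medvedev_le_trans medvedev_le_subset by blast
    have "{null} \<le>\<^sub>M UNIV"
      by (rule medvedev_leI_computable[OF computable_const]) simp
    then show "A \<le>\<^sub>M {null} \<Longrightarrow> A \<le>\<^sub>M UNIV"
      using medvedev_le_trans by blast
  qed
  finally show ?thesis by (simp add: medvedev_le_singleton)
qed

text \<open>A computable member of the meet is tagged; without its tag it is a computable member of
  one side. This is the disjunction property on the side of the degrees.\<close>

lemma inf_mdegree_eq_bot_iff: "inf a b = bot \<longleftrightarrow> a = bot \<or> b = (bot :: mdegree)"
proof
  assume "inf a b = bot"
  then obtain y where y: "y \<in> mp_meet (mrep a) (mrep b)" "y \<le>\<^sub>T null"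
    unfolding inf_mdegree_def mdeg_eq_bot_iff by blast
  then obtain i g where g: "y = prepend i g" "g \<in> mrep a \<or> g \<in> mrep b"
    unfolding mp_meet_def by blast
  have "computable (\<lambda>f e. f (Suc e))"
    by (intro computable_intros)
  from turing_le_computable[OF this, of y] have "g \<le>\<^sub>T null"
    using g y(2) turing_le_trans by auto
  then show "a = bot \<or> b = bot"
    using g(2) mdeg_eq_bot_iff mdeg_mrep by metis
qed (auto simp: inf_absorb1 inf_absorb2)

section \<open>Join prime degrees\<close>

text \<open>Prescribing finitely many values of \<open>f\<close> leaves its Turing degree
  unchanged.\<close>

lemma dense_if_turing_invariant:
  assumes "f \<in> X" and X: "\<And>g. g \<le>\<^sub>T f \<Longrightarrow> f \<le>\<^sub>T g \<Longrightarrow> g \<in> X"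
  shows "dense X"
  unfolding dense_def
proof (intro allI)
  fix h n
  have "patch n f (patch n h f) = f"
    by (auto simp: patch_def)
  then have "patch n h f \<in> X"
    using X turing_le_computable[OF computable_patch] by metis
  moreover have "agree n h (patch n h f)"
    by (simp add: agree_def patch_def)
  ultimately show "\<exists>g\<in>X. agree n h g" by blast
qed

lemma interleave_turing_le: "g \<le>\<^sub>T k \<Longrightarrow> h \<le>\<^sub>T k \<Longrightarrow> g \<oplus> h \<le>\<^sub>T k"
  using mp_join_le_iff[of "{g}" "{h}" "{k}"] by (simp add: medvedev_le_singleton mp_join_def)

lemma turing_le_prepend: "f \<le>\<^sub>T prepend i f"
proof -
  have "computable (\<lambda>f e. f (Suc e))"
    by (intro computable_intros)
  from turing_le_computable[OF this, of "prepend i f"] show ?thesis by simp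
qed

text \<open>A concrete representative of a finite meet in which the component can be read off at
  position 0.\<close>

definition tagged :: "nat set \<Rightarrow> (nat \<Rightarrow> mass_problem) \<Rightarrow> mass_problem" where
  "tagged K B = {prepend i g | i g. i \<in> K \<and> g \<in> B i}"

lemma tagged_le: "i \<in> K \<Longrightarrow> tagged K B \<le>\<^sub>M B i"
  by (rule medvedev_leI_computable[OF computable_prepend[of i]]) (auto simp: tagged_def)

lemma le_tagged:
  assumes "finite K" and B: "\<And>i. i \<in> K \<Longrightarrow> E \<le>\<^sub>M B i"
  shows "E \<le>\<^sub>M tagged K B"
proof -
  have "\<forall>i\<in>K. \<exists>p. \<forall>g\<in>B i. \<exists>y\<in>E. \<forall>x. run g p x (y x)"
    using B by (simp add: medvedev_le_iff_prog)
  from bchoice[OF this] obtain p where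
    p: "\<forall>i\<in>K. \<forall>g\<in>B i. \<exists>y\<in>E. \<forall>x. run g (p i) x (y x)" by blast
  obtain n where n: "\<And>i. i \<in> K \<Longrightarrow> i < n"
    using assms(1) unfolding finite_nat_set_iff_bounded by blast
  show ?thesis
  proof (rule medvedev_leI_universal)
    have "computable (\<lambda>f e. if e < n then code (p e) else 0)"
      by (rule computable_finite_table)
    moreover have "computable (\<lambda>f e. f 0)"
      by (intro computable_intros)
    ultimately show "computable (\<lambda>f e. if f 0 < n then code (p (f 0)) else 0)"
      by (rule computable_comp)
    show "computable (\<lambda>f e. f (Suc e))"
      by (intro computable_intros)
    fix f assume "f \<in> tagged K B"
    then obtain i g where g: "f = prepend i g" "i \<in> K" "g \<in> B i"
      by (auto simp: tagged_def)
    then obtain y where "y \<in> E" "\<forall>x. run g (p i) x (y x)"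
      using p by blast
    then show "\<exists>y\<in>E. \<forall>x. \<exists>q. code q = (if f 0 < n then code (p (f 0)) else 0) \<and>
        run (\<lambda>e. f (Suc e)) q x (y x)"
      using g n by auto
  qed
qed

text \<open>
  Let \<open>h \<in> D\<close>. By density, a search finds a tag \<open>i\<close> that the reduction outputs on \<open>g \<oplus> h\<close> for some
  \<open>g \<in> Z\<close>; this relies on finitely much of \<open>g\<close>, which a variant of \<open>f i \<in> Z\<close> shares. If \<open>h\<close> were
  below \<open>f i\<close>, so would be the member of the \<open>i\<close>-th component computed from this variant and \<open>h\<close>.
\<close>

lemma tagged_le_if_dense:
  fixes f :: "nat \<Rightarrow> nat \<Rightarrow> nat"
  assumes antichain: "\<And>i j. i \<noteq> j \<Longrightarrow> \<not> f i \<le>\<^sub>T f j"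
    and Z: "Z = {g. \<forall>i\<in>T. \<not> g \<le>\<^sub>T f i}" "Z \<noteq> {}" and disjoint: "K \<inter> T = {}"
    and le: "tagged K (\<lambda>i. {g. \<not> g \<le>\<^sub>T f i}) \<le>\<^sub>M mp_join Z D"
  shows "tagged K (\<lambda>i. {g. \<not> g \<le>\<^sub>T f i}) \<le>\<^sub>M D"
proof -
  let ?M = "tagged K (\<lambda>i. {g. \<not> g \<le>\<^sub>T f i})"
  obtain p where "\<And>f. f \<in> mp_join Z D \<Longrightarrow> \<exists>y\<in>?M. \<forall>x. run f p x (y x)"
    using le medvedev_leE by blast
  then have p: "\<exists>y\<in>?M. \<forall>x. run (g \<oplus> h) p x (y x)" if "g \<in> Z" "h \<in> D" for g h
    using that unfolding mp_join_def by blast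
  have dense: "dense Z"
  proof -
    obtain g where "g \<in> Z" using Z(2) by blast
    then show ?thesis
      by (rule dense_if_turing_invariant) (use Z(1) \<open>g \<in> Z\<close> turing_le_trans in blast)
  qed
  define Q where "Q = (\<lambda>h (e :: nat) n. derivation (facts (pr1 n)) \<and> compatible h (facts (pr1 n)) \<and>
    fact_of (code p) 0 (pr2 n) \<in> set (facts (pr1 n)))"
  have "decidable (\<lambda>h e. Q h (pr1 e) (pr2 e))"
    unfolding Q_def
    by (intro computable_intros decidable_mem_facts decidable_derivation decidable_compatible)
  from search_program[OF this] obtain s where
    s: "\<And>h e. \<exists>n. Q h e n \<Longrightarrow> \<exists>n. Q h e n \<and> run h s e n" by metis
  have "computable (\<lambda>h e. if pr1 e = 0 then pr2 (pr2 e) else h (pr1 e - 1))"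
    by (intro computable_intros)
  then obtain r where r: "\<And>h x n. run h r (pair x n) (if x = 0 then pr2 n else h (x - 1))"
    unfolding computable_def by (metis fst_conv snd_conv prod_encode_inverse)
  obtain c where c: "\<And>h x. run h c x x"
    using computable_id unfolding computable_def by blast
  \<comment> \<open>The search runs on the fixed input 0, so all \<open>x\<close> share one tag;
    \<open>r\<close> prepends it to \<open>h\<close>.\<close>
  let ?q = "Comp r (Pairing c (Comp s Zero))"
  have "\<exists>y\<in>?M. \<forall>x. run h ?q x (y x)" if h: "h \<in> D" for h
  proof -
    obtain g where g: "g \<in> Z" using Z(2) by blast
    obtain y where "run (g \<oplus> h) p 0 y"
      using p[OF g h] by blast
    then obtain cs where cs: "derivation cs" "obeys (g \<oplus> h) cs" "fact_of (code p) 0 y \<in> set cs"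
      unfolding run_iff_derivation by blast
    obtain C where C: "facts C = cs"
      using ex_facts by blast
    have "compatible h cs"
      unfolding compatible_iff[OF dense] using cs(2) g by blast
    then have "Q h 0 (pair C y)"
      using cs by (simp add: Q_def C)
    then obtain n where n: "Q h 0 n" "run h s 0 n"
      using s by blast
    have tag: "i = pr2 n" if "g \<in> Z" "obeys (g \<oplus> h) (facts (pr1 n))"
      "\<forall>x. run (g \<oplus> h) p x (prepend i y x)" for g i y
    proof -
      have "run (g \<oplus> h) p 0 (pr2 n)"
        using n(1) that(2) run_if_derivation unfolding Q_def by blast
      moreover have "run (g \<oplus> h) p 0 i"
        using that(3) prepend_simps(1) by metis
      ultimately show ?thesis using run_functional by blast
    qed
    have compat: "compatible h (facts (pr1 n))"
      using n(1) by (simp add: Q_def)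
    obtain g' where g': "g' \<in> Z" "obeys (g' \<oplus> h) (facts (pr1 n))"
      using compat compatible_iff[OF dense] by blast
    then have "pr2 n \<in> K"
      using p[OF g'(1) h] tag[OF g'] unfolding tagged_def by blast
    moreover have "\<not> h \<le>\<^sub>T f (pr2 n)"
    proof
      assume le: "h \<le>\<^sub>T f (pr2 n)"
      \<comment> \<open>Compatibility does not refer to the dense set, so the derivation found is
        also realised by some oracle Turing equivalent to \<open>f (pr2 n)\<close>.\<close>
      define Y where "Y = {g. g \<le>\<^sub>T f (pr2 n) \<and> f (pr2 n) \<le>\<^sub>T g}"
      have "dense Y"
        by (rule dense_if_turing_invariant[where f = "f (pr2 n)"]) (auto simp: Y_def turing_le_refl)
      then obtain g where g: "g \<in> Y" "obeys (g \<oplus> h) (facts (pr1 n))"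
        using compat unfolding compatible_iff[OF \<open>dense Y\<close>] by blast
      have "pr2 n \<noteq> i" if "i \<in> T" for i
        using that disjoint \<open>pr2 n \<in> K\<close> by blast
      then have "f (pr2 n) \<in> Z"
        using antichain by (simp add: Z(1))
      then have "g \<in> Z"
        using g(1) turing_le_trans unfolding Z(1) Y_def by blast
      then obtain i y where y: "\<forall>x. run (g \<oplus> h) p x (prepend i y x)" "\<not> y \<le>\<^sub>T f i"
        using p[OF _ h] unfolding tagged_def by blast
      have "i = pr2 n"
        using tag[OF \<open>g \<in> Z\<close> g(2) y(1)] .
      moreover have "prepend i y \<le>\<^sub>T g \<oplus> h"
        using y(1) unfolding turing_le_def by blast
      then have "y \<le>\<^sub>T f (pr2 n)"
        using turing_le_prepend turing_le_trans interleave_turing_le g(1) le unfolding Y_def by blast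
      ultimately show False using y(2) by simp
    qed
    \<comment> \<open>Only the tag is taken from the reduction; the solution of the component is
      \<open>h\<close> itself.\<close>
    ultimately have "prepend (pr2 n) h \<in> ?M"
      by (auto simp: tagged_def)
    moreover have "run h ?q x (prepend (pr2 n) h x)" for x
    proof -
      have "run h (Pairing c (Comp s Zero)) x (pair x n)"
        by (intro run_Pairing c run_Comp[OF run_Zero n(2)])
      moreover have "(if x = 0 then pr2 n else h (x - 1)) = prepend (pr2 n) h x"
        by (cases x) auto
      ultimately show ?thesis using run_Comp[OF _ r, of h _ x x n] by simp
    qed
    ultimately show ?thesis by blast
  qed
  then show ?thesis by (rule medvedev_leI)
qed

section \<open>Kripke models in initial segments of the Medvedev degrees\<close>

primrec forces :: "'w::order set \<Rightarrow> (nat \<Rightarrow> 'w set) \<Rightarrow> 'w \<Rightarrow> form \<Rightarrow> bool" where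
  "forces W V w (Var n) \<longleftrightarrow> w \<in> V n"
| "forces W V w (Neg \<phi>) \<longleftrightarrow> (\<forall>v\<in>W. w \<le> v \<longrightarrow> \<not> forces W V v \<phi>)"
| "forces W V w (And \<phi> \<psi>) \<longleftrightarrow> forces W V w \<phi> \<and> forces W V w \<psi>"
| "forces W V w (Or \<phi> \<psi>) \<longleftrightarrow> forces W V w \<phi> \<or> forces W V w \<psi>"
| "forces W V w (Imp \<phi> \<psi>) \<longleftrightarrow> (\<forall>v\<in>W. w \<le> v \<longrightarrow> forces W V v \<phi> \<longrightarrow> forces W V v \<psi>)"

definition upset :: "'w::order set \<Rightarrow> 'w set \<Rightarrow> bool" where
  "upset W U \<longleftrightarrow> U \<subseteq> W \<and> (\<forall>u\<in>U. \<forall>v\<in>W. u \<le> v \<longrightarrow> v \<in> U)"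

lemma upsetD: "upset W U \<Longrightarrow> u \<in> U \<Longrightarrow> v \<in> W \<Longrightarrow> u \<le> v \<Longrightarrow> v \<in> U"
  by (simp add: upset_def)

lemma upset_forces:
  assumes "\<And>n. upset W (V n)"
  shows "upset W {w \<in> W. forces W V w \<phi>}"
proof (induction \<phi>)
  case (Var n)
  then show ?case using assms[of n] by (auto simp: upset_def)
qed (auto simp: upset_def intro: order_trans)

lemma initial_segment_simps:
  "carrier (initial_segment medvedev a) = {b. b \<le> a}"
  "greatest (initial_segment medvedev a) = a"
  "least (initial_segment medvedev a) = bot"
  "join (initial_segment medvedev a) = sup"
  "meet (initial_segment medvedev a) = inf"
  "impl (initial_segment medvedev a) = impl_mdegree"
  by (simp_all add: initial_segment_def medvedev_def fun_eq_iff less_eq_mdegree_def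
      bot_mdegree_def sup_mdegree_def inf_mdegree_def impl_mdegree_def)

lemma not_in_ThI:
  assumes "\<And>n. v n \<le> a" and "eval (initial_segment medvedev a) v \<phi> \<noteq> bot"
  shows "\<phi> \<notin> Th (initial_segment medvedev a)"
  using assms by (auto simp: Th_def initial_segment_simps)

locale antichain =
  fixes F :: mass_problem and f :: "nat \<Rightarrow> nat \<Rightarrow> nat" and I :: "nat set"
  assumes finite_I: "finite I"
    and F: "F \<noteq> {}" "closed F" "\<And>y. y \<in> F \<Longrightarrow> \<not> y \<le>\<^sub>T null" "\<And>i y. y \<in> F \<Longrightarrow> \<not> y \<le>\<^sub>T f i"
    and antichain: "\<And>i j. i \<noteq> j \<Longrightarrow> \<not> f i \<le>\<^sub>T f j"
begin

text \<open>The least degree not below that of \<open>{f i}\<close>: a mass problem has a member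
  computable from \<open>f i\<close> or is a subset of \<open>cone i\<close>.\<close>

definition cone :: "nat \<Rightarrow> mass_problem" where
  "cone i = {g. \<not> g \<le>\<^sub>T f i}"

text \<open>Including \<open>F\<close> keeps the meet nonempty: at \<open>s = I\<close> it gives the
  top, and elsewhere it is absorbed, since every cone contains \<open>F\<close>.\<close>

definition atom :: "nat set \<Rightarrow> mdegree" where
  "atom s = Inf_fin (insert (mdeg F) ((\<lambda>i. mdeg (cone i)) ` (I - s)))"

text \<open>
  The degree of a set of worlds is the join of those \<^term>\<open>atom s\<close> that have to be refuted, hence \<open>s\<close>
  ranges over the complement.
\<close>

definition degree_of :: "nat set set \<Rightarrow> mdegree" where
  "degree_of U = Sup_fin (insert bot (atom ` (Pow I - U)))"

lemma le_atom_iff: "d \<le> atom s \<longleftrightarrow> d \<le> mdeg F \<and> (\<forall>i\<in>I - s. d \<le> mdeg (cone i))"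
  unfolding atom_def by (subst Inf_fin.bounded_iff) (use finite_I in auto)

lemma degree_of_le_iff: "degree_of U \<le> d \<longleftrightarrow> (\<forall>s\<in>Pow I - U. atom s \<le> d)"
  unfolding degree_of_def by (subst Sup_fin.bounded_iff) (use finite_I in auto)

lemma atom_mono: "s \<subseteq> t \<Longrightarrow> atom s \<le> atom t"
  using le_atom_iff[of "atom s" s] by (auto simp: le_atom_iff)

lemma atom_le_F: "atom s \<le> mdeg F"
  using le_atom_iff[of "atom s" s] by simp

lemma atom_le_cone: "i \<in> I - s \<Longrightarrow> atom s \<le> mdeg (cone i)"
  using le_atom_iff[of "atom s" s] by simp

lemma atom_Int: "inf (atom s) (atom t) \<le> atom (s \<inter> t)"
  unfolding le_atom_iff using atom_le_F atom_le_cone by (auto intro: le_infI1 le_infI2)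

lemma atom_I: "atom I = mdeg F"
  by (simp add: atom_def)

lemma atom_le_degree_of: "s \<subseteq> I \<Longrightarrow> s \<notin> U \<Longrightarrow> atom s \<le> degree_of U"
  using degree_of_le_iff[of U "degree_of U"] by auto

lemma degree_of_antimono: "U \<subseteq> V \<Longrightarrow> degree_of V \<le> degree_of U"
  unfolding degree_of_le_iff using atom_le_degree_of by auto

lemma degree_of_empty: "degree_of {} = mdeg F"
proof (rule order_antisym)
  show "degree_of {} \<le> mdeg F"
    unfolding degree_of_le_iff using atom_le_F by simp
  show "mdeg F \<le> degree_of {}"
    using atom_le_degree_of[of I "{}"] by (simp add: atom_I)
qed

lemma degree_of_Int: "degree_of (U \<inter> V) = sup (degree_of U) (degree_of V)"
proof (rule order_antisym)
  show "degree_of (U \<inter> V) \<le> sup (degree_of U) (degree_of V)"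
    unfolding degree_of_le_iff using atom_le_degree_of by (auto intro: le_supI1 le_supI2)
qed (auto intro: degree_of_antimono)

text \<open>Distributivity reduces the claim to meets of two atoms, which lie below
  \<open>atom (s \<inter> t)\<close>. The world \<open>s \<inter> t\<close> is below
  \<open>s\<close> and \<open>t\<close>, hence outside both upsets.\<close>

lemma degree_of_Un:
  assumes U: "upset (Pow I) U" and V: "upset (Pow I) V"
  shows "degree_of (U \<union> V) = inf (degree_of U) (degree_of V)"
proof (rule order_antisym)
  let ?A = "\<lambda>U. insert bot (atom ` (Pow I - U))"
  have fin: "finite (?A U)" for U
    using finite_I by simp
  have "inf a b \<le> degree_of (U \<union> V)" if "a \<in> ?A U" "b \<in> ?A V" for a b
  proof (cases "a = bot \<or> b = bot")
    case False
    then have a: "a \<in> atom ` (Pow I - U)" and b: "b \<in> atom ` (Pow I - V)"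
      using that by simp_all
    obtain s where s: "s \<in> Pow I - U" "a = atom s"
      using imageE[OF a] .
    obtain t where t: "t \<in> Pow I - V" "b = atom t"
      using imageE[OF b] .
    have "s \<inter> t \<notin> U \<union> V"
      using upsetD[OF U, of "s \<inter> t" s] upsetD[OF V, of "s \<inter> t" t] s(1) t(1) by auto
    then have "atom (s \<inter> t) \<le> degree_of (U \<union> V)"
      using s(1) by (intro atom_le_degree_of) auto
    then show ?thesis
      using atom_Int s(2) t(2) order_trans by blast
  qed (auto simp: inf_absorb1 inf_absorb2)
  then show "inf (degree_of U) (degree_of V) \<le> degree_of (U \<union> V)"
    unfolding degree_of_def[of U] degree_of_def[of V]
    by (subst inf_Sup2_distrib[OF fin _ fin])
      (auto intro!: Sup_fin.boundedI finite_subset[OF _ finite_imageI[OF finite_cartesian_product[OF fin fin],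
        of "\<lambda>(a, b). inf a b" U V]])
qed (auto intro: degree_of_antimono)

text \<open>Its degree bounds \<open>degree_of U\<close> for every upset \<open>U\<close> that
  contains \<open>t\<close>, yet it can be cancelled from reductions of
  \<open>atom t\<close>.\<close>

definition avoiding :: "nat set \<Rightarrow> mass_problem" where
  "avoiding t = {g. \<forall>i\<in>t. \<not> g \<le>\<^sub>T f i}"

lemma avoiding_nonempty: "avoiding t \<noteq> {}"
proof -
  obtain y where "y \<in> F" using F(1) by blast
  then have "y \<in> avoiding t" using F(4) by (simp add: avoiding_def)
  then show ?thesis by blast
qed

lemma dense_avoiding: "dense (avoiding t)"
proof -
  obtain g where "g \<in> avoiding t"
    using avoiding_nonempty by blast
  then show ?thesis
    by (rule dense_if_turing_invariant) (use \<open>g \<in> avoiding t\<close> turing_le_trans in \<open>unfold avoiding_def, blast\<close>)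
qed

text \<open>For \<open>t = I\<close> this is the density theorem for \<open>F\<close>. Otherwise the
  tags \<open>I - t\<close> are disjoint from \<open>t\<close>, as \<open>tagged_le_if_dense\<close>
  demands.\<close>

lemma atom_prime:
  assumes "t \<subseteq> I" and le: "atom t \<le> sup (mdeg (avoiding t)) d"
  shows "atom t \<le> d"
proof -
  obtain D where d: "d = mdeg D"
    by (metis mdeg_mrep)
  show ?thesis
  proof (cases "t = I")
    case True
    then have "F \<le>\<^sub>M mp_join (avoiding t) D"
      using le by (simp add: atom_I d sup_mdeg mdeg_le_mdeg_iff)
    then have "F \<le>\<^sub>M D"
      using medvedev_le_if_dense[OF F(2) dense_avoiding] by blast
    then show ?thesis
      using True by (simp add: atom_I d mdeg_le_mdeg_iff)
  next
    case False
    then obtain i where i: "i \<in> I - t"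
      using assms(1) by blast
    let ?M = "tagged (I - t) cone"
    have cone: "cone = (\<lambda>i. {g. \<not> g \<le>\<^sub>T f i})"
      by (simp add: cone_def fun_eq_iff)
    have "mdeg ?M \<le> mdeg (cone j)" if "j \<in> I - t" for j
      using tagged_le[OF that] by (simp add: mdeg_le_mdeg_iff)
    moreover have "mdeg (cone i) \<le> mdeg F"
      unfolding mdeg_le_mdeg_iff by (rule medvedev_le_subset) (use F(4) in \<open>auto simp: cone_def\<close>)
    ultimately have "mdeg ?M \<le> atom t"
      using i order_trans unfolding le_atom_iff by blast
    then have "?M \<le>\<^sub>M mp_join (avoiding t) D"
      using le order_trans unfolding d sup_mdeg mdeg_le_mdeg_iff[symmetric] by blast
    then have "?M \<le>\<^sub>M D"
      unfolding cone
      using tagged_le_if_dense[OF antichain avoiding_def avoiding_nonempty, of "I - t" t D] by blast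
    obtain E where E: "atom t = mdeg E"
      by (metis mdeg_mrep)
    have "E \<le>\<^sub>M ?M"
    proof (rule le_tagged)
      show "E \<le>\<^sub>M cone j" if "j \<in> I - t" for j
        using atom_le_cone[OF that] by (simp add: E mdeg_le_mdeg_iff)
    qed (use finite_I in simp)
    then show ?thesis
      using \<open>?M \<le>\<^sub>M D\<close> medvedev_le_trans unfolding E d mdeg_le_mdeg_iff by blast
  qed
qed

text \<open>The hard direction meets a world \<open>t \<in> U - V\<close> above \<open>s\<close>.
  All of \<open>degree_of U\<close> lies below \<open>avoiding t\<close>, so primality moves
  \<open>atom t\<close> under \<open>d\<close>.\<close>

lemma degree_of_arrow:
  assumes U: "upset (Pow I) U"
  shows "impl_mdegree (degree_of U) (degree_of V) =
    degree_of {s \<in> Pow I. \<forall>t\<in>Pow I. s \<subseteq> t \<longrightarrow> t \<in> U \<longrightarrow> t \<in> V}" (is "_ = degree_of ?W")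
proof (rule impl_mdegree_eqI)
  fix d
  show "degree_of ?W \<le> d \<longleftrightarrow> degree_of V \<le> sup (degree_of U) d"
  proof
    assume W: "degree_of ?W \<le> d"
    show "degree_of V \<le> sup (degree_of U) d"
      unfolding degree_of_le_iff[of V]
    proof
      fix s assume s: "s \<in> Pow I - V"
      show "atom s \<le> sup (degree_of U) d"
      proof (cases "s \<in> U")
        case True
        then have "atom s \<le> degree_of ?W"
          using s by (intro atom_le_degree_of) auto
        then show ?thesis using W by (auto intro: le_supI2)
      next
        case False
        then show ?thesis using s atom_le_degree_of by (auto intro: le_supI1)
      qed
    qed
  next
    assume V: "degree_of V \<le> sup (degree_of U) d"
    show "degree_of ?W \<le> d"
      unfolding degree_of_le_iff[of ?W]
    proof
      fix s assume "s \<in> Pow I - ?W"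
      then obtain t where t: "t \<subseteq> I" "s \<subseteq> t" "t \<in> U" "t \<notin> V"
        by auto
      have "degree_of U \<le> mdeg (avoiding t)"
        unfolding degree_of_le_iff
      proof
        fix r assume r: "r \<in> Pow I - U"
        \<comment> \<open>Since \<open>U\<close> is an upset, \<open>r\<close> misses some
          \<open>i \<in> t\<close>, and \<open>cone i\<close> lies between \<open>atom r\<close> and
          \<open>avoiding t\<close>.\<close>
        then have "\<not> t \<subseteq> r"
          using U t(3) by (auto simp: upset_def)
        then obtain i where i: "i \<in> t" "i \<notin> r" by blast
        have "cone i \<le>\<^sub>M avoiding t"
          by (rule medvedev_le_subset) (use i in \<open>auto simp: cone_def avoiding_def\<close>)
        then have "mdeg (cone i) \<le> mdeg (avoiding t)"
          by (simp add: mdeg_le_mdeg_iff)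
        moreover have "atom r \<le> mdeg (cone i)"
          using i t(1) by (intro atom_le_cone) auto
        ultimately show "atom r \<le> mdeg (avoiding t)"
          by (rule order_trans[rotated])
      qed
      then have "sup (degree_of U) d \<le> sup (mdeg (avoiding t)) d"
        by (rule sup_mono) simp
      moreover have "atom t \<le> degree_of V"
        using t by (intro atom_le_degree_of)
      ultimately have "atom t \<le> sup (mdeg (avoiding t)) d"
        using V order_trans by blast
      from atom_prime[OF t(1) this] show "atom s \<le> d"
        using atom_mono[OF t(2)] order_trans by blast
    qed
  qed
qed

text \<open>The atom at the root \<open>{}\<close> is a finite meet of nonzero degrees: computable
  functions are below every \<open>f j\<close>, so no cone contains one.\<close>

lemma degree_of_neq_bot:
  assumes "{} \<notin> U"
  shows "degree_of U \<noteq> bot"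
proof
  assume "degree_of U = bot"
  then have "atom {} = bot"
    using atom_le_degree_of[of "{}" U] assms by (simp add: bot_unique)
  moreover have "Inf_fin (insert (mdeg F) ((\<lambda>i. mdeg (cone i)) ` J)) \<noteq> bot" if "finite J" for J
    using that
  proof (induction J)
    case empty
    show ?case using F(3) by (simp add: mdeg_eq_bot_iff)
  next
    case (insert j J)
    have "mdeg (cone j) \<noteq> bot"
      using turing_le_trans[OF _ null_turing_le] by (auto simp: mdeg_eq_bot_iff cone_def)
    then show ?case
      using insert by (simp add: insert_commute[of "mdeg F"] inf_mdegree_eq_bot_iff)
  qed
  ultimately show False
    using finite_I by (simp add: atom_def)
qed

lemma eval_degree_of:
  assumes V: "\<And>n. upset (Pow I) (V n)"
  shows "eval (initial_segment medvedev (mdeg F)) (\<lambda>n. degree_of (V n)) \<phi> =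
    degree_of {s \<in> Pow I. forces (Pow I) V s \<phi>}"
proof -
  have up: "upset (Pow I) {s \<in> Pow I. forces (Pow I) V s \<chi>}" for \<chi>
    by (rule upset_forces[OF V])
  show ?thesis
  proof (induction \<phi>)
    case (Var n)
    have "{s \<in> Pow I. s \<in> V n} = V n"
      using V[of n] by (auto simp: upset_def)
    then show ?case by simp
  next
    case (Neg \<phi>)
    show ?case
      using degree_of_arrow[OF up[of \<phi>], of "{}"]
      by (simp add: Neg initial_segment_simps degree_of_empty)
  next
    case (And \<phi> \<psi>)
    have "{s \<in> Pow I. forces (Pow I) V s (And \<phi> \<psi>)} =
        {s \<in> Pow I. forces (Pow I) V s \<phi>} \<inter> {s \<in> Pow I. forces (Pow I) V s \<psi>}" by auto
    then show ?case
      by (simp add: And initial_segment_simps degree_of_Int)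
  next
    case (Or \<phi> \<psi>)
    have "{s \<in> Pow I. forces (Pow I) V s (Or \<phi> \<psi>)} =
        {s \<in> Pow I. forces (Pow I) V s \<phi>} \<union> {s \<in> Pow I. forces (Pow I) V s \<psi>}" by auto
    then show ?case
      using degree_of_Un[OF up[of \<phi>] up[of \<psi>]]
      by (simp add: Or initial_segment_simps)
  next
    case (Imp \<phi> \<psi>)
    show ?case
      using degree_of_arrow[OF up[of \<phi>], of "{s \<in> Pow I. forces (Pow I) V s \<psi>}"]
      by (simp add: Imp initial_segment_simps cong: conj_cong)
  qed
qed

lemma not_in_Th_if_not_forces:
  assumes V: "\<And>n. upset (Pow I) (V n)" and "\<not> forces (Pow I) V {} \<phi>"
  shows "\<phi> \<notin> Th (initial_segment medvedev (mdeg F))"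
proof (rule not_in_ThI)
  show "degree_of (V n) \<le> mdeg F" for n
    using degree_of_antimono[of "{}"] by (simp add: degree_of_empty)
  show "eval (initial_segment medvedev (mdeg F)) (\<lambda>n. degree_of (V n)) \<phi> \<noteq> bot"
    unfolding eval_degree_of[OF V] by (rule degree_of_neq_bot) (use assms(2) in simp)
qed

end

lemma weak_excluded_middle_not_in_Th:
  assumes F: "F \<noteq> {}" "closed F" "\<And>y. y \<in> F \<Longrightarrow> \<not> y \<le>\<^sub>T null"
  shows "Or (Neg (Var 0)) (Neg (Neg (Var 0))) \<notin> Th (initial_segment medvedev (mdeg F))"
proof -
  obtain f where f: "f \<in> F"
    using F(1) by blast
  obtain b c where b: "\<And>y. y \<in> F \<Longrightarrow> \<not> y \<le>\<^sub>T b" and c: "\<And>y. y \<in> F \<Longrightarrow> \<not> y \<le>\<^sub>T c"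
    and bc: "f \<le>\<^sub>T b \<oplus> c"
    using ex_turing_split[OF F(2,3)] by metis
  \<comment> \<open>Meeting with \<open>F\<close> moves the degree of \<open>{b}\<close> into the
    segment; by distributivity its join with \<open>{c}\<close> still lies above
    \<open>F\<close>.\<close>
  let ?a = "inf (mdeg {b}) (mdeg F)"
  have "mdeg F \<le> sup (mdeg {b}) (mdeg {c})"
    using f bc by (auto simp: sup_mdeg mdeg_le_mdeg_iff mp_join_def medvedev_le_singleton)
  then have "mdeg F \<le> sup ?a (mdeg {c})"
    by (simp add: sup_inf_distrib2)
  then have "impl_mdegree ?a (mdeg F) \<le> mdeg {c}"
    by (simp only: impl_mdegree_le_iff)
  moreover have "\<not> mdeg F \<le> mdeg {b}" "\<not> mdeg F \<le> mdeg {c}"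
    using b c by (auto simp: mdeg_le_mdeg_iff medvedev_le_singleton)
  moreover have "impl_mdegree a a' = bot \<longleftrightarrow> a' \<le> a" for a a'
    using impl_mdegree_le_iff[of a a' bot] by (simp add: bot_unique)
  \<comment> \<open>If the negation of \<open>?a\<close> were zero, \<open>F\<close> would be below
    \<open>{b}\<close>; if its double negation were zero, \<open>F\<close> would be below
    \<open>{c}\<close>.\<close>
  ultimately have "inf (impl_mdegree ?a (mdeg F)) (impl_mdegree (impl_mdegree ?a (mdeg F)) (mdeg F)) \<noteq> bot"
    unfolding inf_mdegree_eq_bot_iff using order_trans by auto
  then show ?thesis
    by (intro not_in_ThI[where v = "\<lambda>_. ?a"]) (simp_all add: initial_segment_simps)
qed

section \<open>Completeness of the logic Jan for finite Boolean frames\<close>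

text \<open>Substitution is confined to theorems of \<open>Jan\<close> and never applied to
  assumptions, so the deduction theorem holds.\<close>

inductive_set derivable :: "form set \<Rightarrow> form set" for \<Gamma> where
  derivable_Jan: "\<phi> \<in> Jan \<Longrightarrow> \<phi> \<in> derivable \<Gamma>"
| derivable_assm: "\<phi> \<in> \<Gamma> \<Longrightarrow> \<phi> \<in> derivable \<Gamma>"
| derivable_mp: "Imp \<phi> \<psi> \<in> derivable \<Gamma> \<Longrightarrow> \<phi> \<in> derivable \<Gamma> \<Longrightarrow> \<psi> \<in> derivable \<Gamma>"

lemma derivable_axiom: "\<phi> \<in> ipc_axioms \<Longrightarrow> \<phi> \<in> derivable \<Gamma>"
  by (rule derivable_Jan) (simp add: Jan_def ipc_axiom)

lemma derivable_empty: "derivable {} = Jan"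
proof
  show "derivable {} \<subseteq> Jan"
  proof
    fix \<phi> assume "\<phi> \<in> derivable {}"
    then show "\<phi> \<in> Jan"
      by induction (auto simp: Jan_def intro: modus_ponens)
  qed
qed (auto intro: derivable_Jan)

lemma derivable_mono: "\<phi> \<in> derivable \<Gamma> \<Longrightarrow> \<Gamma> \<subseteq> \<Delta> \<Longrightarrow> \<phi> \<in> derivable \<Delta>"
  by (induction rule: derivable.induct) (auto intro: derivable.intros)

lemma derivable_imp_const: "\<psi> \<in> derivable \<Gamma> \<Longrightarrow> Imp \<phi> \<psi> \<in> derivable \<Gamma>"
  using derivable_mp[OF derivable_axiom[OF ipc_axioms.intros(1)]] .

lemma derivable_imp_refl: "Imp \<phi> \<phi> \<in> derivable \<Gamma>"
  using derivable_mp[OF derivable_mp[OF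
      derivable_axiom[OF ipc_axioms.intros(2)[of \<phi> "Imp \<phi> \<phi>" \<phi>]]
      derivable_axiom[OF ipc_axioms.intros(1)]] derivable_axiom[OF ipc_axioms.intros(1)]] .

lemma deduction: "\<psi> \<in> derivable (insert \<phi> \<Gamma>) \<longleftrightarrow> Imp \<phi> \<psi> \<in> derivable \<Gamma>"
proof
  show "Imp \<phi> \<psi> \<in> derivable \<Gamma>" if "\<psi> \<in> derivable (insert \<phi> \<Gamma>)"
    using that
  proof induction
    case (derivable_Jan \<psi>)
    then show ?case by (intro derivable_imp_const derivable.derivable_Jan)
  next
    case (derivable_assm \<psi>)
    then show ?case
      using derivable_imp_refl derivable_imp_const derivable.derivable_assm by blast
  next
    case (derivable_mp \<chi> \<psi>)
    show ?case
      using derivable.derivable_mp[OF derivable.derivable_mp[OF derivable_axiom[OF ipc_axioms.intros(2)]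
          derivable_mp.IH(1)] derivable_mp.IH(2)] .
  qed
  show "\<psi> \<in> derivable (insert \<phi> \<Gamma>)" if "Imp \<phi> \<psi> \<in> derivable \<Gamma>"
    using derivable_mp[OF derivable_mono[OF that subset_insertI] derivable_assm] by blast
qed

text \<open>Modus ponens combines two members of the chain, the larger of which proves both
  premises.\<close>

lemma derivable_Union_chain:
  assumes "\<phi> \<in> derivable (\<Union>\<C>)" and "\<C> \<noteq> {}" and "subset.chain A \<C>"
  shows "\<exists>\<Gamma>\<in>\<C>. \<phi> \<in> derivable \<Gamma>"
  using assms(1)
proof induction
  case (derivable_mp \<phi> \<psi>)
  then obtain \<Gamma> \<Delta> where "\<Gamma> \<in> \<C>" "Imp \<phi> \<psi> \<in> derivable \<Gamma>" "\<Delta> \<in> \<C>" "\<phi> \<in> derivable \<Delta>"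
    by blast
  moreover from this have "\<Gamma> \<subseteq> \<Delta> \<or> \<Delta> \<subseteq> \<Gamma>"
    using assms(3) unfolding subset_chain_def by blast
  ultimately show ?case
    using derivable.derivable_mp derivable_mono by metis
qed (use assms(2) in \<open>auto intro: derivable.intros\<close>)

definition prime_theory :: "form set \<Rightarrow> bool" where
  "prime_theory \<Delta> \<longleftrightarrow> derivable \<Delta> \<subseteq> \<Delta> \<and> \<Delta> \<noteq> UNIV \<and>
    (\<forall>\<phi> \<psi>. Or \<phi> \<psi> \<in> \<Delta> \<longrightarrow> \<phi> \<in> \<Delta> \<or> \<psi> \<in> \<Delta>)"

text \<open>Lindenbaum by Zorn: if \<open>\<Delta>\<close> is maximal among the extensions that do
  not derive \<open>\<chi>\<close>, every formula outside \<open>\<Delta>\<close> implies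
  \<open>\<chi>\<close>. Closure and primeness follow.\<close>

lemma ex_prime_theory:
  assumes "\<chi> \<notin> derivable \<Gamma>"
  obtains \<Delta> where "prime_theory \<Delta>" and "\<Gamma> \<subseteq> \<Delta>" and "\<chi> \<notin> \<Delta>"
proof -
  let ?A = "{\<Delta>. \<Gamma> \<subseteq> \<Delta> \<and> \<chi> \<notin> derivable \<Delta>}"
  have "\<exists>M\<in>?A. \<forall>X\<in>?A. M \<subseteq> X \<longrightarrow> X = M"
  proof (rule subset_Zorn_nonempty)
    show "?A \<noteq> {}" using assms by blast
    fix \<C> assume \<C>: "\<C> \<noteq> {}" "subset.chain ?A \<C>"
    then have sub: "\<C> \<subseteq> ?A" by (simp add: subset_chain_def)
    have "\<chi> \<notin> derivable (\<Union>\<C>)"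
      using derivable_Union_chain[OF _ \<C>] sub by blast
    moreover have "\<Gamma> \<subseteq> \<Union>\<C>"
      using \<C>(1) sub by blast
    ultimately show "\<Union>\<C> \<in> ?A" by blast
  qed
  then obtain \<Delta> where "\<Delta> \<in> ?A" and *: "\<forall>X\<in>?A. \<Delta> \<subseteq> X \<longrightarrow> X = \<Delta>" ..
  then have \<Delta>: "\<Gamma> \<subseteq> \<Delta>" "\<chi> \<notin> derivable \<Delta>" by simp_all
  have max: "X = \<Delta>" if "\<Gamma> \<subseteq> X" "\<chi> \<notin> derivable X" "\<Delta> \<subseteq> X" for X
    using * that by simp
  have not_in: "Imp \<phi> \<chi> \<in> derivable \<Delta>" if "\<phi> \<notin> \<Delta>" for \<phi>
  proof (rule ccontr)
    assume "Imp \<phi> \<chi> \<notin> derivable \<Delta>"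
    then have "insert \<phi> \<Delta> = \<Delta>"
      using \<Delta>(1) by (intro max) (auto simp: deduction)
    then show False using that by blast
  qed
  have closed: "derivable \<Delta> \<subseteq> \<Delta>"
    using not_in derivable_mp \<Delta>(2) by blast
  moreover have "\<phi> \<in> \<Delta> \<or> \<psi> \<in> \<Delta>" if "Or \<phi> \<psi> \<in> \<Delta>" for \<phi> \<psi>
  proof (rule ccontr)
    assume "\<not> (\<phi> \<in> \<Delta> \<or> \<psi> \<in> \<Delta>)"
    then have "Imp \<phi> \<chi> \<in> derivable \<Delta>" "Imp \<psi> \<chi> \<in> derivable \<Delta>"
      using not_in by blast+
    then have "Imp (Or \<phi> \<psi>) \<chi> \<in> derivable \<Delta>"
      using derivable_mp[OF derivable_mp[OF derivable_axiom[OF ipc_axioms.intros(8)]]] by blast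
    then show False
      using derivable_mp[OF _ derivable_assm[OF that]] \<Delta>(2) by blast
  qed
  moreover have "\<chi> \<notin> \<Delta>" using \<Delta>(2) derivable_assm by blast
  ultimately show ?thesis
    using that[of \<Delta>] \<Delta>(1) unfolding prime_theory_def by blast
qed

context
  fixes \<Delta> assumes prime: "prime_theory \<Delta>"
begin

lemma prime_theory_axiom: "\<phi> \<in> ipc_axioms \<Longrightarrow> \<phi> \<in> \<Delta>"
  using prime derivable_axiom unfolding prime_theory_def by blast

lemma prime_theory_mp: "Imp \<phi> \<psi> \<in> \<Delta> \<Longrightarrow> \<phi> \<in> \<Delta> \<Longrightarrow> \<psi> \<in> \<Delta>"
  using prime derivable_mp derivable_assm unfolding prime_theory_def by blast

lemma prime_theory_And: "And \<phi> \<psi> \<in> \<Delta> \<longleftrightarrow> \<phi> \<in> \<Delta> \<and> \<psi> \<in> \<Delta>"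
  using prime_theory_mp prime_theory_axiom[OF ipc_axioms.intros(3)]
    prime_theory_axiom[OF ipc_axioms.intros(4)] prime_theory_axiom[OF ipc_axioms.intros(5)] by blast

lemma prime_theory_Or: "Or \<phi> \<psi> \<in> \<Delta> \<longleftrightarrow> \<phi> \<in> \<Delta> \<or> \<psi> \<in> \<Delta>"
  using prime prime_theory_mp prime_theory_axiom[OF ipc_axioms.intros(6)]
    prime_theory_axiom[OF ipc_axioms.intros(7)] unfolding prime_theory_def by blast

lemma prime_theory_consistent: "Neg \<phi> \<in> \<Delta> \<Longrightarrow> \<phi> \<notin> \<Delta>"
  using prime prime_theory_mp prime_theory_axiom[OF ipc_axioms.intros(10)]
  unfolding prime_theory_def by blast

lemma ex_prime_theory_Imp:
  assumes "Imp \<phi> \<psi> \<notin> \<Delta>"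
  shows "\<exists>\<Delta>'. prime_theory \<Delta>' \<and> \<Delta> \<subseteq> \<Delta>' \<and> \<phi> \<in> \<Delta>' \<and> \<psi> \<notin> \<Delta>'"
proof -
  have "\<psi> \<notin> derivable (insert \<phi> \<Delta>)"
    using assms prime by (auto simp: deduction prime_theory_def)
  from ex_prime_theory[OF this] show ?thesis by (metis insert_subset)
qed

lemma ex_prime_theory_Neg:
  assumes "Neg \<phi> \<notin> \<Delta>"
  shows "\<exists>\<Delta>'. prime_theory \<Delta>' \<and> \<Delta> \<subseteq> \<Delta>' \<and> \<phi> \<in> \<Delta>'"
proof -
  have "\<exists>\<psi>. \<psi> \<notin> derivable (insert \<phi> \<Delta>)"
  proof (rule ccontr)
    assume "\<nexists>\<psi>. \<psi> \<notin> derivable (insert \<phi> \<Delta>)"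
    then have "Imp \<phi> \<psi> \<in> \<Delta>" for \<psi>
      using prime by (auto simp: deduction prime_theory_def)
    then have "Neg \<phi> \<in> \<Delta>"
      using prime_theory_mp[OF prime_theory_mp[OF prime_theory_axiom[OF ipc_axioms.intros(9)]]] by blast
    then show False using assms by blast
  qed
  then show ?thesis
    using ex_prime_theory by (metis insert_subset)
qed

lemma prime_theory_weak_excluded_middle: "Neg \<phi> \<in> \<Delta> \<or> Neg (Neg \<phi>) \<in> \<Delta>"
proof -
  have "subst (\<lambda>_. \<phi>) (Or (Neg (Var 0)) (Neg (Neg (Var 0)))) \<in> Jan"
    unfolding Jan_def by (rule instance_of) simp
  then have "Or (Neg \<phi>) (Neg (Neg \<phi>)) \<in> \<Delta>"
    using prime derivable_Jan unfolding prime_theory_def by auto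
  then show ?thesis by (simp only: prime_theory_Or)
qed

end

section \<open>Filtration and the unravelling into a Boolean frame\<close>

primrec subformulas :: "form \<Rightarrow> form set" where
  "subformulas (Var n) = {Var n}"
| "subformulas (Neg \<phi>) = insert (Neg \<phi>) (subformulas \<phi>)"
| "subformulas (And \<phi> \<psi>) = insert (And \<phi> \<psi>) (subformulas \<phi> \<union> subformulas \<psi>)"
| "subformulas (Or \<phi> \<psi>) = insert (Or \<phi> \<psi>) (subformulas \<phi> \<union> subformulas \<psi>)"
| "subformulas (Imp \<phi> \<psi>) = insert (Imp \<phi> \<psi>) (subformulas \<phi> \<union> subformulas \<psi>)"

lemma finite_subformulas: "finite (subformulas \<phi>)"
  by (induction \<phi>) auto

lemma subformulas_refl: "\<phi> \<in> subformulas \<phi>"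
  by (cases \<phi>) auto

lemma subformulas_trans: "\<psi> \<in> subformulas \<phi> \<Longrightarrow> subformulas \<psi> \<subseteq> subformulas \<phi>"
  by (induction \<phi>) auto

lemma Union_finite_chain_mem:
  assumes "finite C" and "C \<noteq> {}" and "\<And>a b. a \<in> C \<Longrightarrow> b \<in> C \<Longrightarrow> a \<subseteq> b \<or> b \<subseteq> a"
  shows "\<Union>C \<in> C"
  using assms
proof (induction rule: finite_ne_induct)
  case (insert a C)
  then have "\<Union>C \<in> C" by simp
  then have "a \<subseteq> \<Union>C \<or> \<Union>C \<subseteq> a"
    using insert.prems by blast
  then have "\<Union>(insert a C) = \<Union>C \<or> \<Union>(insert a C) = a"
    by auto
  then show ?case using \<open>\<Union>C \<in> C\<close> by auto
qed simp

text \<open>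
  A refutation of \<open>\<phi>\<close> is filtrated to a finite frame \<open>P\<close>, which has a top by weak excluded middle. The
  Boolean frame of the sets of worlds of \<open>P\<close> is mapped onto \<open>P\<close> by a bounded morphism that sends a
  chain to its largest element and everything else to the top.
\<close>

theorem Jan_complete:
  assumes "\<phi> \<notin> Jan"
  obtains I :: "nat set" and V where
    "finite I" and "\<And>n. upset (Pow I) (V n)" and "\<not> forces (Pow I) V {} \<phi>"
proof -
  obtain \<Gamma> where \<Gamma>: "prime_theory \<Gamma>" "\<phi> \<notin> \<Gamma>"
    using ex_prime_theory[of \<phi> "{}"] assms derivable_empty by metis
  let ?S = "subformulas \<phi>"
  define P where "P = {\<Delta> \<inter> ?S | \<Delta>. prime_theory \<Delta> \<and> \<Gamma> \<subseteq> \<Delta>}"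
  define r where "r = \<Gamma> \<inter> ?S"
  have r: "r \<in> P" "\<And>w. w \<in> P \<Longrightarrow> r \<subseteq> w"
    using \<Gamma>(1) by (auto simp: P_def r_def)
  have "finite P"
    by (rule finite_subset[of _ "Pow ?S"]) (auto simp: P_def finite_subformulas)
  then obtain t where "t \<in> P" and t_max: "\<And>w. w \<in> P \<Longrightarrow> t \<subseteq> w \<Longrightarrow> w = t"
    using finite_has_maximal[of P] r(1) by (metis empty_iff)
  have P_cases: "\<exists>\<Delta>. w = \<Delta> \<inter> ?S \<and> prime_theory \<Delta> \<and> \<Gamma> \<subseteq> \<Delta>" if "w \<in> P" for w
    using that by (auto simp: P_def)
  have t: "w \<subseteq> t" if "w \<in> P" for w
  proof
    fix \<psi> assume \<psi>: "\<psi> \<in> w"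
    obtain \<Delta> where \<Delta>: "w = \<Delta> \<inter> ?S" "prime_theory \<Delta>" "\<Gamma> \<subseteq> \<Delta>"
      using P_cases[OF \<open>w \<in> P\<close>] by blast
    obtain \<Theta> where \<Theta>: "t = \<Theta> \<inter> ?S" "prime_theory \<Theta>" "\<Gamma> \<subseteq> \<Theta>"
      using P_cases[OF \<open>t \<in> P\<close>] by blast
    \<comment> \<open>Weak excluded middle at the root puts \<open>Neg (Neg \<psi>)\<close> into
      \<open>\<Gamma>\<close>, so \<open>\<Theta>\<close> extends to a prime theory with
      \<open>\<psi>\<close>, whose trace is \<open>t\<close> by maximality. Whole theories are used
      because these negations need not be subformulas of \<open>\<phi>\<close>.\<close>
    have "Neg \<psi> \<notin> \<Gamma>"
      using prime_theory_consistent[OF \<Delta>(2)] \<psi> \<Delta> by blast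
    then have "Neg \<psi> \<notin> \<Theta>"
      using prime_theory_weak_excluded_middle[OF \<Gamma>(1)] prime_theory_consistent[OF \<Theta>(2)] \<Theta>(3)
      by blast
    then obtain \<Delta>' where \<Delta>': "prime_theory \<Delta>'" "\<Theta> \<subseteq> \<Delta>'" "\<psi> \<in> \<Delta>'"
      using ex_prime_theory_Neg[OF \<Theta>(2)] by blast
    then have "\<Delta>' \<inter> ?S = t"
      using \<Theta> by (intro t_max) (auto simp: P_def)
    then show "\<psi> \<in> t" using \<Delta>'(3) \<psi> \<Delta>(1) by blast
  qed
  have P_And: "And \<psi> \<chi> \<in> w \<longleftrightarrow> \<psi> \<in> w \<and> \<chi> \<in> w" if S: "And \<psi> \<chi> \<in> ?S" and "w \<in> P" for \<psi> \<chi> w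
  proof -
    obtain \<Delta> where "w = \<Delta> \<inter> ?S" "prime_theory \<Delta>"
      using P_cases[OF \<open>w \<in> P\<close>] by blast
    then show ?thesis
      using S subformulas_trans[OF S] subformulas_refl[of \<psi>] subformulas_refl[of \<chi>]
      by (auto simp: prime_theory_And)
  qed
  have P_Or: "Or \<psi> \<chi> \<in> w \<longleftrightarrow> \<psi> \<in> w \<or> \<chi> \<in> w" if S: "Or \<psi> \<chi> \<in> ?S" and "w \<in> P" for \<psi> \<chi> w
  proof -
    obtain \<Delta> where "w = \<Delta> \<inter> ?S" "prime_theory \<Delta>"
      using P_cases[OF \<open>w \<in> P\<close>] by blast
    then show ?thesis
      using S subformulas_trans[OF S] subformulas_refl[of \<psi>] subformulas_refl[of \<chi>]
      by (auto simp: prime_theory_Or)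
  qed
  have P_Neg: "Neg \<psi> \<in> w \<longleftrightarrow> (\<forall>v\<in>P. w \<subseteq> v \<longrightarrow> \<psi> \<notin> v)" if S: "Neg \<psi> \<in> ?S" and "w \<in> P" for \<psi> w
  proof
    show "\<forall>v\<in>P. w \<subseteq> v \<longrightarrow> \<psi> \<notin> v" if "Neg \<psi> \<in> w"
    proof (intro ballI impI)
      fix v assume "v \<in> P" "w \<subseteq> v"
      then obtain \<Delta> where "v = \<Delta> \<inter> ?S" "prime_theory \<Delta>"
        using P_cases by blast
      then show "\<psi> \<notin> v"
        using prime_theory_consistent \<open>w \<subseteq> v\<close> that by blast
    qed
    obtain \<Delta> where \<Delta>: "w = \<Delta> \<inter> ?S" "prime_theory \<Delta>" "\<Gamma> \<subseteq> \<Delta>"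
      using P_cases[OF \<open>w \<in> P\<close>] by blast
    have "\<psi> \<in> ?S"
      using subformulas_trans[OF S] subformulas_refl[of \<psi>] by auto
    show "Neg \<psi> \<in> w" if *: "\<forall>v\<in>P. w \<subseteq> v \<longrightarrow> \<psi> \<notin> v"
    proof (rule ccontr)
      assume "Neg \<psi> \<notin> w"
      then have "Neg \<psi> \<notin> \<Delta>" using \<Delta>(1) S by blast
      then obtain \<Delta>' where \<Delta>': "prime_theory \<Delta>'" "\<Delta> \<subseteq> \<Delta>'" "\<psi> \<in> \<Delta>'"
        using ex_prime_theory_Neg[OF \<Delta>(2)] by blast
      then have "\<Delta>' \<inter> ?S \<in> P" "w \<subseteq> \<Delta>' \<inter> ?S" "\<psi> \<in> \<Delta>' \<inter> ?S"
        using \<Delta> \<open>\<psi> \<in> ?S\<close> by (auto simp: P_def)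
      then show False using * by blast
    qed
  qed
  have P_Imp: "Imp \<psi> \<chi> \<in> w \<longleftrightarrow> (\<forall>v\<in>P. w \<subseteq> v \<longrightarrow> \<psi> \<in> v \<longrightarrow> \<chi> \<in> v)"
    if S: "Imp \<psi> \<chi> \<in> ?S" and "w \<in> P" for \<psi> \<chi> w
  proof
    obtain \<Delta> where \<Delta>: "w = \<Delta> \<inter> ?S" "prime_theory \<Delta>" "\<Gamma> \<subseteq> \<Delta>"
      using P_cases[OF \<open>w \<in> P\<close>] by blast
    have sub: "\<psi> \<in> ?S" "\<chi> \<in> ?S"
      using subformulas_trans[OF S] subformulas_refl[of \<psi>] subformulas_refl[of \<chi>] by auto
    show "\<forall>v\<in>P. w \<subseteq> v \<longrightarrow> \<psi> \<in> v \<longrightarrow> \<chi> \<in> v" if "Imp \<psi> \<chi> \<in> w"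
    proof (intro ballI impI)
      fix v assume "v \<in> P" "w \<subseteq> v" "\<psi> \<in> v"
      then obtain \<Delta> where "v = \<Delta> \<inter> ?S" "prime_theory \<Delta>"
        using P_cases by blast
      then show "\<chi> \<in> v"
        using prime_theory_mp \<open>w \<subseteq> v\<close> \<open>\<psi> \<in> v\<close> that sub(2) by blast
    qed
    show "Imp \<psi> \<chi> \<in> w" if *: "\<forall>v\<in>P. w \<subseteq> v \<longrightarrow> \<psi> \<in> v \<longrightarrow> \<chi> \<in> v"
    proof (rule ccontr)
      assume "Imp \<psi> \<chi> \<notin> w"
      then have "Imp \<psi> \<chi> \<notin> \<Delta>" using \<Delta>(1) S by blast
      then obtain \<Delta>' where \<Delta>': "prime_theory \<Delta>'" "\<Delta> \<subseteq> \<Delta>'" "\<psi> \<in> \<Delta>'" "\<chi> \<notin> \<Delta>'"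
        using ex_prime_theory_Imp[OF \<Delta>(2)] by blast
      then have "\<Delta>' \<inter> ?S \<in> P" "w \<subseteq> \<Delta>' \<inter> ?S" "\<psi> \<in> \<Delta>' \<inter> ?S" "\<chi> \<notin> \<Delta>' \<inter> ?S"
        using \<Delta> sub by (auto simp: P_def)
      then show False using * by blast
    qed
  qed
  obtain e where e: "bij_betw e {..<card P} P"
    using ex_bij_betw_nat_finite[OF \<open>finite P\<close>] by (auto simp: atLeast0LessThan)
  define I where "I = {..<card P}"
  define chain where "chain s \<longleftrightarrow> (\<forall>i\<in>s. \<forall>j\<in>s. e i \<subseteq> e j \<or> e j \<subseteq> e i)" for s
  \<comment> \<open>The union of a nonempty chain is its largest element; \<open>r\<close> supplies
    the root as the value at the empty chain.\<close>
  define m where "m s = (if chain s then r \<union> \<Union>(e ` s) else t)" for s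
  have e_mem: "e i \<in> P" if "i \<in> I" for i
    using that e by (auto simp: I_def bij_betw_def)
  have m_mem: "m s \<in> P" if "s \<subseteq> I" for s
  proof (cases "chain s \<and> s \<noteq> {}")
    case True
    then have "\<Union>(e ` s) \<in> e ` s"
      using finite_subset[OF that] by (intro Union_finite_chain_mem) (auto simp: I_def chain_def)
    then have "\<Union>(e ` s) \<in> P"
      using e_mem that by auto
    then show ?thesis
      using True r(2) by (simp add: m_def Un_absorb1)
  next
    case False
    then show ?thesis using r(1) \<open>t \<in> P\<close> by (auto simp: m_def)
  qed
  have m_mono: "m s \<subseteq> m s'" if "s \<subseteq> s'" "s' \<subseteq> I" for s s'
  proof (cases "chain s'")
    case True
    then have "chain s" using that(1) by (auto simp: chain_def)
    then show ?thesis using True that(1) by (auto simp: m_def)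
  next
    case False
    then show ?thesis using t[OF m_mem[of s]] that by (simp add: m_def)
  qed
  \<comment> \<open>The back condition of a bounded morphism: a chain is extended by the number of
    \<open>v\<close>, while a set that is no chain already sits at the top.\<close>
  have m_lift: "\<exists>s'. s \<subseteq> s' \<and> s' \<subseteq> I \<and> m s' = v" if s: "s \<subseteq> I" and v: "v \<in> P" "m s \<subseteq> v" for s v
  proof (cases "chain s")
    case True
    have "v \<in> e ` I"
      using v(1) e by (simp add: I_def bij_betw_def)
    then obtain i where i: "i \<in> I" "e i = v" by fast
    have sub: "e j \<subseteq> v" if "j \<in> s" for j
      using that True v(2) by (auto simp: m_def)
    then have "chain (insert i s)"
      using True i(2) by (auto simp: chain_def)
    then have "m (insert i s) = v"
      using sub r(2)[OF v(1)] i(2) by (auto simp: m_def)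
    then show ?thesis using i(1) s by blast
  next
    case False
    then have "v = m s"
      using v(2) t[OF v(1)] by (simp add: m_def)
    then show ?thesis using s by blast
  qed
  define V where "V n = {s \<in> Pow I. Var n \<in> m s}" for n
  have truth: "forces (Pow I) V s \<psi> \<longleftrightarrow> \<psi> \<in> m s" if "\<psi> \<in> ?S" "s \<subseteq> I" for s \<psi>
    using that
  proof (induction \<psi> arbitrary: s)
    case (Var n)
    then show ?case by (simp add: V_def)
  next
    case (Neg \<psi>)
    have "\<psi> \<in> ?S"
      using subformulas_trans[OF Neg.prems(1)] subformulas_refl[of \<psi>] by auto
    then have "forces (Pow I) V s (Neg \<psi>) \<longleftrightarrow> (\<forall>s'. s \<subseteq> s' \<longrightarrow> s' \<subseteq> I \<longrightarrow> \<psi> \<notin> m s')"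
      using Neg.IH by auto
    also have "\<dots> \<longleftrightarrow> (\<forall>v\<in>P. m s \<subseteq> v \<longrightarrow> \<psi> \<notin> v)"
      using m_lift[OF Neg.prems(2)] m_mono m_mem by metis
    also have "\<dots> \<longleftrightarrow> Neg \<psi> \<in> m s"
      using P_Neg[OF Neg.prems(1) m_mem[OF Neg.prems(2)]] by simp
    finally show ?case .
  next
    case (And \<psi> \<chi>)
    have "\<psi> \<in> ?S" "\<chi> \<in> ?S"
      using subformulas_trans[OF And.prems(1)] subformulas_refl[of \<psi>] subformulas_refl[of \<chi>] by auto
    then show ?case
      using And.IH And.prems(2) P_And[OF And.prems(1) m_mem[OF And.prems(2)]] by simp
  next
    case (Or \<psi> \<chi>)
    have "\<psi> \<in> ?S" "\<chi> \<in> ?S"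
      using subformulas_trans[OF Or.prems(1)] subformulas_refl[of \<psi>] subformulas_refl[of \<chi>] by auto
    then show ?case
      using Or.IH Or.prems(2) P_Or[OF Or.prems(1) m_mem[OF Or.prems(2)]] by simp
  next
    case (Imp \<psi> \<chi>)
    have "\<psi> \<in> ?S" "\<chi> \<in> ?S"
      using subformulas_trans[OF Imp.prems(1)] subformulas_refl[of \<psi>] subformulas_refl[of \<chi>] by auto
    then have "forces (Pow I) V s (Imp \<psi> \<chi>) \<longleftrightarrow>
        (\<forall>s'. s \<subseteq> s' \<longrightarrow> s' \<subseteq> I \<longrightarrow> \<psi> \<in> m s' \<longrightarrow> \<chi> \<in> m s')"
      using Imp.IH by auto
    also have "\<dots> \<longleftrightarrow> (\<forall>v\<in>P. m s \<subseteq> v \<longrightarrow> \<psi> \<in> v \<longrightarrow> \<chi> \<in> v)"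
      using m_lift[OF Imp.prems(2)] m_mono m_mem by metis
    also have "\<dots> \<longleftrightarrow> Imp \<psi> \<chi> \<in> m s"
      using P_Imp[OF Imp.prems(1) m_mem[OF Imp.prems(2)]] by simp
    finally show ?case .
  qed
  show ?thesis
  proof
    show "finite I" by (simp add: I_def)
    show "upset (Pow I) (V n)" for n
      unfolding upset_def
    proof (intro conjI ballI impI)
      fix s s' assume "s \<in> V n" "s' \<in> Pow I" "s \<le> s'"
      then show "s' \<in> V n" using m_mono[of s s'] by (auto simp: V_def)
    qed (auto simp: V_def)
    have "m {} = r" by (simp add: m_def chain_def)
    then show "\<not> forces (Pow I) V {} \<phi>"
      using truth[OF subformulas_refl, of "{}"] \<Gamma>(2) by (simp add: r_def)
  qed
qed

theorem theorem6p1: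
  fixes F :: "(nat \<Rightarrow> nat) set"
  assumes "F \<noteq> {}"
    and "closed F"
    and "mdeg F \<noteq> least medvedev"
  shows "Th (initial_segment medvedev (mdeg F)) \<subset> Jan"
proof -
  have "least medvedev = bot"
    by (simp add: medvedev_def bot_mdegree_def)
  then have null: "\<not> y \<le>\<^sub>T null" if "y \<in> F" for y
    using assms(3) that mdeg_eq_bot_iff by metis
  have "\<phi> \<in> Jan" if "\<phi> \<in> Th (initial_segment medvedev (mdeg F))" for \<phi>
  proof (rule ccontr)
    assume "\<phi> \<notin> Jan"
    then obtain I :: "nat set" and V where
      I: "finite I" "\<And>n. upset (Pow I) (V n)" "\<not> forces (Pow I) V {} \<phi>"
      using Jan_complete by blast
    obtain f :: "nat \<Rightarrow> nat \<Rightarrow> nat" where f: "\<And>i y. y \<in> F \<Longrightarrow> \<not> y \<le>\<^sub>T f i" "\<And>i j. i \<noteq> j \<Longrightarrow> \<not> f i \<le>\<^sub>T f j"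
      using ex_turing_antichain[OF assms(2) null] by metis
    interpret antichain F f I
      by unfold_locales (use assms null I(1) f in auto)
    show False
      using not_in_Th_if_not_forces[OF I(2,3)] that by blast
  qed
  moreover have "Or (Neg (Var 0)) (Neg (Neg (Var 0))) \<in> Jan"
    using instance_of[of "Or (Neg (Var 0)) (Neg (Neg (Var 0)))" _ Var] by (simp add: Jan_def)
  ultimately show ?thesis
    using weak_excluded_middle_not_in_Th[OF assms(1,2) null] by blast
qed

end
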